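(* Let $\mathcal{B}(n,d,d)$ be the set of $d$-regular bipartite graphs with $2n$ nodes and a given bipartition (each side of size $n$). Then the mixing time of the bipartite switch chain on $\mathcal{B}(n,d,d)$ satisfies \[\tau(\varepsilon)\leq 32\,d^{17}n^6\big(2dn\log(2dn)+\log(\varepsilon^{-1})\big).\]
   Context: The bipartite switch chain on a set $\mathcal{B}$ of simple bipartite graphs with fixed bipartition $X,Y$ and fixed degrees is the Markov chain which, from the current graph $B$, with probability $1/2$ does nothing, and otherwise chooses two distinct edges $\{x_1,y_1\},\{x_2,y_2\}$ of $B$ ($x_i\in X$, $y_i\in Y$) uniformly at random and, if $x_1\neq x_2$, $y_1\neq y_2$ and neither $\{x_1,y_2\}$ nor $\{x_2,y_1\}$ is an edge of $B$, replaces the two chosen edges by $\{x_1,y_2\},\{x_2,y_1\}$ (otherwise it stays at $B$). Its stationary distribution is uniform, $\pi$. The mixing time is $\tau(\varepsilon)=\max_{B_0}\min\{T: d_{TV}(P^t(B_0,\cdot),\pi)\leq\varepsilon\text{ for all }t\geq T\}$, where $P^t$ is the $t$-step transition distribution and $d_{TV}$ total variation distance. *)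

theory Defs
  imports Complex_Main
begin

text \<open>A bipartite graph with bipartition X = Y = {0..<n} (two disjoint copies)
  is represented by its edge set, a set of pairs (x,y) with x in X, y in Y.\<close>

type_synonym bgraph = "(nat \<times> nat) set"

definition regular_bip :: "nat \<Rightarrow> nat \<Rightarrow> bgraph set" where
  "regular_bip n d = {B. B \<subseteq> {..<n} \<times> {..<n}
      \<and> (\<forall>x<n. card {y. (x, y) \<in> B} = d)
      \<and> (\<forall>y<n. card {x. (x, y) \<in> B} = d)}"

text \<open>Ordered pairs of distinct edges of B (choosing two distinct edges uniformly
  at random; ordered vs. unordered choice gives the same switch distribution).\<close>
definition edge_pairs :: "bgraph \<Rightarrow> ((nat \<times> nat) \<times> (nat \<times> nat)) set" where
  "edge_pairs B = {(e1, e2). e1 \<in> B \<and> e2 \<in> B \<and> e1 \<noteq> e2}"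

definition switch :: "bgraph \<Rightarrow> (nat \<times> nat) \<Rightarrow> (nat \<times> nat) \<Rightarrow> bgraph" where
  "switch B e1 e2 =
     (let (x1, y1) = e1; (x2, y2) = e2 in
      if x1 \<noteq> x2 \<and> y1 \<noteq> y2 \<and> (x1, y2) \<notin> B \<and> (x2, y1) \<notin> B
      then (B - {(x1, y1), (x2, y2)}) \<union> {(x1, y2), (x2, y1)}
      else B)"

definition switch_P :: "bgraph \<Rightarrow> bgraph \<Rightarrow> real" where
  "switch_P B B' =
     (if edge_pairs B = {} then (if B' = B then 1 else 0)
      else (if B' = B then 1/2 else 0)
        + (1/2) * real (card {p \<in> edge_pairs B. switch B (fst p) (snd p) = B'})
                / real (card (edge_pairs B)))"

fun Pt :: "bgraph set \<Rightarrow> nat \<Rightarrow> bgraph \<Rightarrow> bgraph \<Rightarrow> real" where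
  "Pt \<Omega> 0 B0 B = (if B = B0 then 1 else 0)"
| "Pt \<Omega> (Suc t) B0 B = (\<Sum>C\<in>\<Omega>. Pt \<Omega> t B0 C * switch_P C B)"

definition dtv_unif :: "bgraph set \<Rightarrow> (bgraph \<Rightarrow> real) \<Rightarrow> real" where
  "dtv_unif \<Omega> p = (1/2) * (\<Sum>B\<in>\<Omega>. \<bar>p B - 1 / real (card \<Omega>)\<bar>)"

text \<open>Mixing time: max over starting states of the least T such that the
  distance is at most \<epsilon> for all t \<ge> T (max over empty set taken as 0).\<close>
definition mixing_time :: "bgraph set \<Rightarrow> real \<Rightarrow> nat" where
  "mixing_time \<Omega> \<epsilon> = Max (insert 0
     ((\<lambda>B0. LEAST T. \<forall>t\<ge>T. dtv_unif \<Omega> (Pt \<Omega> t B0) \<le> \<epsilon>) ` \<Omega>))"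

end

(* The spectral gap is bounded below by a multicommodity flow, and a lazy symmetric chain with
   Poincare constant R has mixing time at most R (ln N / 2 + ln (1 / eps)) for N states.

   For G, G' in the state space put H = G \<triangle> G'. A pairing of G-edges with G'-edges of H at every
   vertex splits H into alternating closed trails, and the flow averages over all pairings. Each
   trail is processed edge by edge: remove an edge of G, add the following edge of G', and so on.
   A state Z on the way is regular up to degree d - 1 at the start x of the trail and at the current
   vertex y, and L = Z \<triangle> H has degree d + 1 at x and y. In the colouring of H by Z the pairing
   still exchanges the two colours, except for one pair at x and one at y; hence (Z, L), the pairing
   and the two exceptional edges determine G and G', while the number of pairings depends on H only.
   So every step is used by at most (d + 1)^2 times the number of graphs L, with unit total weight.

   Finally Z is replaced by a regular graph: add the edge xy, or if xy is already present,
   replace some edge pq by xq and py. Completions of consecutive states can be chosen equal or one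
   switch apart, and two completions of the same Z are at most two switches apart. *)
theory Submission
  imports Defs "HOL-Analysis.Analysis" "HOL-Library.Nat_Bijection"
begin

section \<open>Contraction of reversible positive semidefinite chains\<close>

text \<open>Laziness enters only through positive semidefiniteness: Cauchy-Schwarz for the quadratic
  form of the chain turns a Poincare inequality directly into contraction in l2.

  On the path side the obstacle is that the intermediate graphs lie outside the state space. Each
  deficient graph therefore gets one fixed completion \<open>fill\<close>, so that the regular graph
  visited at a state depends only on the deficient graph and its two deficient vertices; the cost of
  comparing this completion with other ones is collected in a separate sum over
  \<open>detour\<close>. At both ends of a trail the completion is forced to be the regular graph
  before or after the whole trail, so consecutive trails join without extra steps.

  The power n^6 consists of n^2 for the edge pairs, n for the length of a path, n for the surplus
  graphs per regular graph and n^2 for the detours. The same factors contribute d^12 times a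
  constant. Detours exist only for d >= 2, where d^5 >= 32 absorbs the constant; for d = 1 the
  estimate does without them.\<close>

lemma symmetric_chain_contraction:
  fixes P :: "'a \<Rightarrow> 'a \<Rightarrow> real" and f :: "'a \<Rightarrow> real"
  assumes sym: "\<And>x y. x \<in> \<Omega> \<Longrightarrow> y \<in> \<Omega> \<Longrightarrow> P x y = P y x"
    and psd: "\<And>g. 0 \<le> (\<Sum>x\<in>\<Omega>. \<Sum>y\<in>\<Omega>. g x * P x y * g y)"
    and rows: "\<And>x. x \<in> \<Omega> \<Longrightarrow> (\<Sum>y\<in>\<Omega>. P x y) = 1"
    and gap: "\<And>g. sum g \<Omega> = 0 \<Longrightarrow>
      (\<Sum>x\<in>\<Omega>. \<Sum>y\<in>\<Omega>. g x * P x y * g y) \<le> \<rho> * (\<Sum>x\<in>\<Omega>. (g x)\<^sup>2)"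
    and mean: "sum f \<Omega> = 0" and "0 \<le> \<rho>"
  shows "sum (\<lambda>y. \<Sum>x\<in>\<Omega>. f x * P x y) \<Omega> = 0"
    and "(\<Sum>y\<in>\<Omega>. (\<Sum>x\<in>\<Omega>. f x * P x y)\<^sup>2) \<le> \<rho>\<^sup>2 * (\<Sum>x\<in>\<Omega>. (f x)\<^sup>2)"
proof -
  define F where "F = (\<lambda>g h. \<Sum>x\<in>\<Omega>. \<Sum>y\<in>\<Omega>. g x * P x y * h y)"
  define h where "h = (\<lambda>y. \<Sum>x\<in>\<Omega>. f x * P x y)"
  have "sum h \<Omega> = (\<Sum>x\<in>\<Omega>. \<Sum>y\<in>\<Omega>. f x * P x y)"
    unfolding h_def by (rule sum.swap)
  also have "\<dots> = 0"
    using rows mean by (simp flip: sum_distrib_left)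
  finally have h0: "sum h \<Omega> = 0" .
  then show "sum (\<lambda>y. \<Sum>x\<in>\<Omega>. f x * P x y) \<Omega> = 0" by (simp add: h_def)
  have Fsym: "F g k = F k g" for g k
    unfolding F_def by (subst sum.swap) (auto intro!: sum.cong simp: sym)
  have Fadd: "F (\<lambda>x. s * g x + k x) (\<lambda>x. s * g x + k x)
      = s\<^sup>2 * F g g + 2 * s * F g k + F k k" for s g k
  proof -
    have "F (\<lambda>x. s * g x + k x) (\<lambda>x. s * g x + k x)
      = s\<^sup>2 * F g g + s * F g k + s * F k g + F k k"
      unfolding F_def sum_distrib_left sum.distrib[symmetric]
      by (intro sum.cong refl) (simp add: algebra_simps power2_eq_square)
    then show ?thesis using Fsym[of k g] by simp
  qed
  \<comment> \<open>The number b is both the squared norm of h = P f and F(f, h). Cauchy-Schwarz for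
    F gives b^2 <= a c, while the gap bounds a by \<rho> times the squared norm of f and c by \<rho>
    b; cancelling one b yields the contraction.\<close>
  define a b c where "a = F f f" and "b = (\<Sum>y\<in>\<Omega>. (h y)\<^sup>2)" and "c = F h h"
  have Ffh: "F f h = b"
    unfolding F_def b_def h_def
    by (subst sum.swap) (auto simp: power2_eq_square sum_distrib_right intro!: sum.cong)
  have quad: "0 \<le> s\<^sup>2 * a + 2 * s * b + c" for s
    using psd[of "\<lambda>x. s * f x + h x"] Fadd[of s f h] unfolding a_def c_def Ffh[symmetric]
    by (simp add: F_def)
  have a0: "0 \<le> a" and c0: "0 \<le> c"
    using psd by (auto simp: a_def c_def F_def)
  have b0: "0 \<le> b" unfolding b_def by (intro sum_nonneg) simp
  have af: "a \<le> \<rho> * (\<Sum>x\<in>\<Omega>. (f x)\<^sup>2)" using gap[OF mean] by (simp add: a_def F_def)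
  have cb: "c \<le> \<rho> * b" using gap[OF h0] by (simp add: c_def F_def b_def)
  have CS: "b\<^sup>2 \<le> a * c"
  proof (cases "a = 0")
    case False
    then have "a > 0" using a0 by simp
    then show ?thesis using quad[of "- b / a"]
      by (simp add: field_simps power2_eq_square)
  next
    \<comment> \<open>For a = 0 the quadratic in s degenerates to an affine function, which stays
      nonnegative only if its slope 2 b vanishes.\<close>
    case True
    have "b = 0"
    proof (rule ccontr)
      assume "b \<noteq> 0"
      have "0 \<le> 2 * (- (c + 1) / b) * b + c" using quad[of "- (c + 1) / b"] True by simp
      moreover have "2 * (- (c + 1) / b) * b = - 2 * c - 2" using \<open>b \<noteq> 0\<close> by simp
      ultimately show False using c0 by linarith
    qed
    then show ?thesis using True by simp
  qed
  have fnn: "0 \<le> (\<Sum>x\<in>\<Omega>. (f x)\<^sup>2)" by (intro sum_nonneg) simp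
  have "b \<le> \<rho>\<^sup>2 * (\<Sum>x\<in>\<Omega>. (f x)\<^sup>2)"
  proof (cases "b = 0")
    case True then show ?thesis using fnn by simp
  next
    case False
    then have bp: "b > 0" using b0 by simp
    have "b * b \<le> a * c" using CS by (simp add: power2_eq_square)
    also have "\<dots> \<le> (\<rho> * (\<Sum>x\<in>\<Omega>. (f x)\<^sup>2)) * (\<rho> * b)"
      by (intro mult_mono af cb) (use fnn \<open>0 \<le> \<rho>\<close> c0 in auto)
    finally have "b * b \<le> (\<rho>\<^sup>2 * (\<Sum>x\<in>\<Omega>. (f x)\<^sup>2)) * b"
      by (simp add: power2_eq_square algebra_simps)
    then show ?thesis using bp by (simp add: mult_le_cancel_right)
  qed
  then show "(\<Sum>y\<in>\<Omega>. (\<Sum>x\<in>\<Omega>. f x * P x y)\<^sup>2) \<le> \<rho>\<^sup>2 * (\<Sum>x\<in>\<Omega>. (f x)\<^sup>2)"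
    by (simp add: b_def h_def)
qed

text \<open>The deviation of the t-step distribution from 1/N evolves by the chain itself, keeps sum
  0 and starts with squared norm 1 - 1/N, so its norm is at most \<rho>^t. Passing from l2 to l1
  costs the factor sqrt N.\<close>

lemma dtv_unif_le:
  assumes fin: "finite \<Omega>" and B0: "B0 \<in> \<Omega>"
    and sym: "\<And>x y. x \<in> \<Omega> \<Longrightarrow> y \<in> \<Omega> \<Longrightarrow> switch_P x y = switch_P y x"
    and psd: "\<And>g. 0 \<le> (\<Sum>x\<in>\<Omega>. \<Sum>y\<in>\<Omega>. g x * switch_P x y * g y)"
    and rows: "\<And>x. x \<in> \<Omega> \<Longrightarrow> (\<Sum>y\<in>\<Omega>. switch_P x y) = 1"
    and gap: "\<And>g. sum g \<Omega> = 0 \<Longrightarrow>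
      (\<Sum>x\<in>\<Omega>. \<Sum>y\<in>\<Omega>. g x * switch_P x y * g y) \<le> \<rho> * (\<Sum>x\<in>\<Omega>. (g x)\<^sup>2)"
    and "0 \<le> \<rho>"
  shows "dtv_unif \<Omega> (Pt \<Omega> t B0) \<le> 1 / 2 * sqrt (card \<Omega>) * \<rho> ^ t"
proof -
  define N where "N = real (card \<Omega>)"
  have N: "N > 0" using fin B0 by (auto simp: N_def card_gt_0_iff)
  define q where "q = (\<lambda>t B. Pt \<Omega> t B0 B - 1 / N)"
  have step: "q (Suc t) B = (\<Sum>C\<in>\<Omega>. q t C * switch_P C B)" if "B \<in> \<Omega>" for t B
  proof -
    have "(\<Sum>C\<in>\<Omega>. switch_P C B) = 1"
      using rows[OF that] sym[OF _ that] by (simp cong: sum.cong)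
    then have "(\<Sum>C\<in>\<Omega>. (1 / N) * switch_P C B) = 1 / N"
      by (simp only: sum_distrib_left[symmetric])
    then show ?thesis by (simp add: q_def left_diff_distrib sum_subtractf)
  qed
  have "sum (q t) \<Omega> = 0 \<and> (\<Sum>B\<in>\<Omega>. (q t B)\<^sup>2) \<le> (\<rho> ^ t)\<^sup>2" for t
  proof (induction t)
    case 0
    have s0: "sum (\<lambda>B. if B = B0 then 1 else 0 :: real) \<Omega> = 1"
      using fin B0 by (simp add: sum.delta)
    have m: "sum (q 0) \<Omega> = 0"
      using s0 N by (simp add: q_def sum_subtractf N_def)
    have "(q 0 B)\<^sup>2 = (if B = B0 then 1 else 0) - (1 / N) * (q 0 B) - (1/N) * (if B = B0 then 1 else 0)" for B
      by (auto simp: q_def power2_eq_square field_simps)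
    then have "(\<Sum>B\<in>\<Omega>. (q 0 B)\<^sup>2) = 1 - (1 / N) * sum (q 0) \<Omega> - (1 / N) * 1"
      by (simp only: sum_subtractf sum_distrib_left[symmetric] s0)
    also have "\<dots> \<le> 1" using m N by simp
    finally show ?case using m by simp
  next
    case (Suc t)
    note c = symmetric_chain_contraction[OF sym psd rows gap conjunct1[OF Suc.IH] \<open>0 \<le> \<rho>\<close>]
    have "(\<Sum>B\<in>\<Omega>. (q (Suc t) B)\<^sup>2) \<le> \<rho>\<^sup>2 * (\<Sum>B\<in>\<Omega>. (q t B)\<^sup>2)"
      using c(2) by (simp add: step)
    also have "\<dots> \<le> \<rho>\<^sup>2 * (\<rho> ^ t)\<^sup>2"
      using Suc.IH by (intro mult_left_mono) auto
    finally show ?case using c(1) by (simp add: step power_mult_distrib)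
  qed
  then have q2: "(\<Sum>B\<in>\<Omega>. (q t B)\<^sup>2) \<le> (\<rho> ^ t)\<^sup>2" by blast
  have "(\<Sum>B\<in>\<Omega>. \<bar>q t B\<bar> * 1)\<^sup>2 \<le> (\<Sum>B\<in>\<Omega>. \<bar>q t B\<bar>\<^sup>2) * (\<Sum>B\<in>\<Omega>. 1\<^sup>2)"
    by (rule Cauchy_Schwarz_ineq_sum)
  also have "\<dots> \<le> (\<rho> ^ t)\<^sup>2 * N"
    using q2 N by (simp add: N_def mult_right_mono)
  also have "\<dots> = (sqrt N * \<rho> ^ t)\<^sup>2"
    using N by (simp add: power_mult_distrib)
  finally have "(\<Sum>B\<in>\<Omega>. \<bar>q t B\<bar>)\<^sup>2 \<le> (sqrt N * \<rho> ^ t)\<^sup>2" by simp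
  then have "(\<Sum>B\<in>\<Omega>. \<bar>q t B\<bar>) \<le> sqrt N * \<rho> ^ t"
    by (rule power2_le_imp_le) (use N \<open>0 \<le> \<rho>\<close> in simp)
  then show ?thesis by (simp add: dtv_unif_def q_def N_def)
qed

text \<open>A Poincare constant R means a gap 1/R and hence decay exp(-t/R); K pays for the factor
  sqrt N.\<close>

lemma mixing_time_le:
  assumes fin: "finite \<Omega>"
    and sym: "\<And>x y. x \<in> \<Omega> \<Longrightarrow> y \<in> \<Omega> \<Longrightarrow> switch_P x y = switch_P y x"
    and psd: "\<And>g. 0 \<le> (\<Sum>x\<in>\<Omega>. \<Sum>y\<in>\<Omega>. g x * switch_P x y * g y)"
    and rows: "\<And>x. x \<in> \<Omega> \<Longrightarrow> (\<Sum>y\<in>\<Omega>. switch_P x y) = 1"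
    and gap: "\<And>g. sum g \<Omega> = 0 \<Longrightarrow>
      (\<Sum>x\<in>\<Omega>. (g x)\<^sup>2) \<le> R * ((\<Sum>x\<in>\<Omega>. (g x)\<^sup>2) - (\<Sum>x\<in>\<Omega>. \<Sum>y\<in>\<Omega>. g x * switch_P x y * g y))"
    and R: "2 \<le> R" and eps: "0 < \<epsilon>" "\<epsilon> < 1" and lnN: "ln (card \<Omega>) / 2 \<le> K" and K: "0 \<le> K"
  shows "real (mixing_time \<Omega> \<epsilon>) \<le> R * (K + ln (1 / \<epsilon>))"
proof -
  define M where "M = R * (K + ln (1 / \<epsilon>))"
  have M0: "0 \<le> M" using R K eps by (simp add: M_def)
  define \<rho> where "\<rho> = 1 - 1 / R"
  have \<rho>0: "0 < \<rho>" using R by (simp add: \<rho>_def field_simps)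
  have gap': "(\<Sum>x\<in>\<Omega>. \<Sum>y\<in>\<Omega>. g x * switch_P x y * g y) \<le> \<rho> * (\<Sum>x\<in>\<Omega>. (g x)\<^sup>2)"
    if "sum g \<Omega> = 0" for g
    using gap[OF that] R by (simp add: \<rho>_def field_simps)
  have main: "dtv_unif \<Omega> (Pt \<Omega> t B0) \<le> \<epsilon>" if B0: "B0 \<in> \<Omega>" and t: "nat \<lfloor>M\<rfloor> \<le> t" for B0 t
  proof -
    have N: "card \<Omega> > 0" using fin B0 by (auto simp: card_gt_0_iff)
    have t': "M - 1 \<le> real t" using t M0 by linarith
    \<comment> \<open>Rounding M down loses less than one step. The factor 1/2 in the total
      variation distance saves R ln 2 steps, and this is at least 1 because R >= 2.\<close>
    have "ln 2 \<ge> (1 / 2 :: real)"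
      using ln2_ge_two_thirds by linarith
    then have "1 \<le> R * ln 2" using R mult_mono[of 2 R "1/2" "ln 2"] by simp
    then have "R * (K + ln (1 / \<epsilon>) - ln 2) \<le> real t"
      using t' by (simp add: M_def algebra_simps)
    then have e: "- (real t / R) \<le> ln 2 - K - ln (1 / \<epsilon>)"
      using R by (simp add: field_simps)
    have "\<rho> \<le> exp (- (1 / R))" using exp_ge_add_one_self[of "- (1 / R)"] by (simp add: \<rho>_def)
    then have "\<rho> ^ t \<le> exp (- (1 / R)) ^ t" using \<rho>0 by (intro power_mono) auto
    also have "\<dots> = exp (- (real t / R))" by (simp flip: exp_of_nat_mult)
    also have "\<dots> \<le> exp (ln 2 - K - ln (1 / \<epsilon>))" using e by simp
    finally have \<rho>t: "\<rho> ^ t \<le> exp (ln 2 - K - ln (1 / \<epsilon>))" .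
    have sq: "sqrt (card \<Omega>) = exp (ln (card \<Omega>) / 2)"
      using N by (simp add: ln_sqrt[symmetric])
    have "sqrt (card \<Omega>) * \<rho> ^ t \<le> exp K * exp (ln 2 - K - ln (1 / \<epsilon>))"
      unfolding sq using \<rho>t \<rho>0 lnN by (intro mult_mono) auto
    also have "\<dots> = 2 * \<epsilon>" using eps by (simp add: ln_div exp_diff exp_add)
    finally have "1 / 2 * sqrt (card \<Omega>) * \<rho> ^ t \<le> \<epsilon>" by simp
    then show ?thesis
      using dtv_unif_le[OF fin B0 sym psd rows gap', of t] \<rho>0 by linarith
  qed
  have L: "(LEAST T. \<forall>t\<ge>T. dtv_unif \<Omega> (Pt \<Omega> t B0) \<le> \<epsilon>) \<le> nat \<lfloor>M\<rfloor>" if "B0 \<in> \<Omega>" for B0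
    by (rule Least_le) (use main[OF that] in blast)
  have "mixing_time \<Omega> \<epsilon> \<le> nat \<lfloor>M\<rfloor>"
    unfolding mixing_time_def using fin L by (subst Max_le_iff) auto
  then show ?thesis using M0 unfolding M_def by linarith
qed

section \<open>The switch chain\<close>

text \<open>With \<open>fst\<close> or \<open>snd\<close> for k, one definition serves both sides of
  the bipartition, and degree identities for edge exchanges can be proved for all k at once.\<close>

definition deg :: "('a \<Rightarrow> nat) \<Rightarrow> 'a set \<Rightarrow> nat \<Rightarrow> nat" where
  "deg k B v = card {e \<in> B. k e = v}"

lemma deg_insert:
  "finite B \<Longrightarrow> e \<notin> B \<Longrightarrow> deg k (insert e B) v = deg k B v + of_bool (v = k e)"
proof -
  assume "finite B" "e \<notin> B"
  have "{e' \<in> insert e B. k e' = v} = (if k e = v then insert e {e' \<in> B. k e' = v} else {e' \<in> B. k e' = v})"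
    by auto
  then show ?thesis using \<open>finite B\<close> \<open>e \<notin> B\<close> by (simp add: deg_def)
qed

lemma deg_remove:
  "finite B \<Longrightarrow> e \<in> B \<Longrightarrow> deg k (B - {e}) v + of_bool (v = k e) = deg k B v"
  using deg_insert[of "B - {e}" e k v] by (simp add: insert_absorb)

lemma deg_fst: "deg fst B v = card {y. (v, y) \<in> B}"
proof -
  have "{e \<in> B. fst e = v} = Pair v ` {y. (v, y) \<in> B}" by force
  then show ?thesis by (simp add: deg_def card_image inj_on_def)
qed

lemma deg_snd: "deg snd B v = card {x. (x, v) \<in> B}"
proof -
  have "{e \<in> B. snd e = v} = (\<lambda>x. (x, v)) ` {x. (x, v) \<in> B}" by force
  then show ?thesis by (simp add: deg_def card_image inj_on_def)
qed

lemma regular_bip_iff: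
  "B \<in> regular_bip n d \<longleftrightarrow>
    B \<subseteq> {..<n} \<times> {..<n} \<and> (\<forall>v<n. deg fst B v = d \<and> deg snd B v = d)"
  by (auto simp: regular_bip_def deg_fst deg_snd)

lemma finite_regular_bip: "finite (regular_bip n d)"
  by (rule finite_subset[of _ "Pow ({..<n} \<times> {..<n})"]) (auto simp: regular_bip_def)

lemma regular_bip_finite: "B \<in> regular_bip n d \<Longrightarrow> finite B"
  unfolding regular_bip_def by (auto intro: finite_subset[of _ "{..<n} \<times> {..<n}"])

lemma card_eq_sum_deg:
  assumes "finite B" "k ` B \<subseteq> {..<n}"
  shows "card B = (\<Sum>v<n. deg k B v)"
  using sum.group[of B "{..<n}" k "\<lambda>_. 1 :: nat"] assms unfolding deg_def card_eq_sum by (simp only: lessThan_iff finite_lessThan)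

lemma card_regular_bip: "B \<in> regular_bip n d \<Longrightarrow> card B = d * n"
  using card_eq_sum_deg[of B fst n] regular_bip_finite[of B n d]
  by (fastforce simp: regular_bip_iff mult.commute)

lemma card_edge_pairs:
  assumes "finite B" shows "card (edge_pairs B) = card B * (card B - 1)"
proof -
  have "edge_pairs B = (SIGMA e:B. B - {e})" by (auto simp: edge_pairs_def)
  then show ?thesis using assms by (simp add: card_SigmaI)
qed

lemma finite_edge_pairs: "finite B \<Longrightarrow> finite (edge_pairs B)"
  by (rule finite_subset[of _ "B \<times> B"]) (auto simp: edge_pairs_def)

definition switchable :: "bgraph \<Rightarrow> nat \<Rightarrow> nat \<Rightarrow> nat \<Rightarrow> nat \<Rightarrow> bool" where
  "switchable B x y u w \<longleftrightarrow> (x, y) \<in> B \<and> (u, w) \<in> B \<and> x \<noteq> u \<and> y \<noteq> w \<and> (x, w) \<notin> B \<and> (u, y) \<notin> B"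

lemma switch_switchable:
  "switchable B x y u w \<Longrightarrow> switch B (x, y) (u, w) = insert (x, w) (insert (u, y) (B - {(x, y)} - {(u, w)}))"
  by (auto simp: switch_def switchable_def)

lemma switch_cases:
  assumes "p \<in> edge_pairs B" "switch B (fst p) (snd p) \<noteq> B"
  obtains x y u w where "p = ((x, y), (u, w))" "switchable B x y u w"
  using assms unfolding switch_def switchable_def edge_pairs_def
  by (cases p) (auto simp: Let_def split: prod.splits if_splits)

lemma switch_regular:
  assumes "B \<in> regular_bip n d" "p \<in> edge_pairs B"
  shows "switch B (fst p) (snd p) \<in> regular_bip n d"
proof (cases "switch B (fst p) (snd p) = B")
  case False
  then obtain x y u w where p: "p = ((x, y), (u, w))" and s: "switchable B x y u w"
    using switch_cases[OF assms(2)] by blast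
  have fin: "finite B" using assms(1) by (rule regular_bip_finite)
  let ?B = "insert (x, w) (insert (u, y) (B - {(x, y)} - {(u, w)}))"
  have "deg k ?B v + of_bool (v = k (x, y)) + of_bool (v = k (u, w))
      = deg k B v + of_bool (v = k (x, w)) + of_bool (v = k (u, y))" for k v
    using s fin deg_remove[of B "(x, y)" k v] deg_remove[of "B - {(x, y)}" "(u, w)" k v]
    by (simp add: deg_insert switchable_def)
  from this[of fst] this[of snd] have "deg fst ?B v = deg fst B v" "deg snd ?B v = deg snd B v" for v
    by auto
  moreover have "?B \<subseteq> {..<n} \<times> {..<n}"
    using s assms(1) by (auto simp: switchable_def regular_bip_iff)
  ultimately show ?thesis
    using assms(1) by (simp add: p switch_switchable[OF s] regular_bip_iff)
qed (use assms in simp)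

text \<open>If the pair is switched, these are the two edges created; as \<open>cross\<close> is an
  involution, it turns each switch into its inverse.\<close>

definition cross :: "(nat \<times> nat) \<times> (nat \<times> nat) \<Rightarrow> (nat \<times> nat) \<times> (nat \<times> nat)" where
  "cross p = ((fst (fst p), snd (snd p)), (fst (snd p), snd (fst p)))"

lemma cross_cross [simp]: "cross (cross p) = p"
  by (simp add: cross_def)

lemma switch_reversible:
  assumes "p \<in> edge_pairs B" "switch B (fst p) (snd p) = B'" "B' \<noteq> B"
  shows "cross p \<in> edge_pairs B'" "switch B' (fst (cross p)) (snd (cross p)) = B"
proof -
  obtain x y u w where p: "p = ((x, y), (u, w))" and s: "switchable B x y u w"
    using switch_cases[OF assms(1)] assms(2,3) by blast
  have B': "B' = insert (x, w) (insert (u, y) (B - {(x, y)} - {(u, w)}))"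
    using assms(2) by (simp add: p switch_switchable[OF s])
  show "cross p \<in> edge_pairs B'"
    using s by (auto simp: cross_def p B' edge_pairs_def switchable_def)
  have s': "switchable B' x w u y" using s by (auto simp: B' switchable_def)
  show "switch B' (fst (cross p)) (snd (cross p)) = B"
    using s switch_switchable[OF s'] by (auto simp: cross_def p B' switchable_def)
qed

definition switch_count :: "bgraph \<Rightarrow> bgraph \<Rightarrow> nat" where
  "switch_count B B' = card {p \<in> edge_pairs B. switch B (fst p) (snd p) = B'}"

lemma switch_count_sym:
  assumes "finite B" "finite B'" shows "switch_count B B' = switch_count B' B"
proof (cases "B = B'")
  case False
  have "bij_betw cross {p \<in> edge_pairs B. switch B (fst p) (snd p) = B'}
      {p \<in> edge_pairs B'. switch B' (fst p) (snd p) = B}"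
    using switch_reversible[of _ B B'] switch_reversible[of _ B' B] False
    by (intro bij_betw_byWitness[where f' = cross] ballI) (simp_all del: split_paired_All add: image_subset_iff)
  then show ?thesis unfolding switch_count_def by (rule bij_betw_same_card)
qed simp

text \<open>The unnormalised local Dirichlet form: pairs of edges that admit no switch contribute
  0.\<close>

definition energy :: "(bgraph \<Rightarrow> real) \<Rightarrow> bgraph \<Rightarrow> real" where
  "energy f B = (\<Sum>p\<in>edge_pairs B. (f B - f (switch B (fst p) (snd p)))\<^sup>2)"

lemma energy_nonneg: "0 \<le> energy f B"
  unfolding energy_def by (intro sum_nonneg) simp

lemma switch_le_energy:
  assumes "finite B" "switchable B x y u w"
    and "B' = insert (x, w) (insert (u, y) (B - {(x, y)} - {(u, w)}))"
  shows "(f B - f B')\<^sup>2 \<le> energy f B"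
proof -
  have "((x, y), (u, w)) \<in> edge_pairs B"
    using assms(2) by (auto simp: switchable_def edge_pairs_def)
  from member_le_sum[OF this _ finite_edge_pairs[OF assms(1)], of "\<lambda>p. (f B - f (switch B (fst p) (snd p)))\<^sup>2"]
  show ?thesis by (simp add: energy_def switch_switchable[OF assms(2)] assms(3))
qed

lemma sum_switch_count:
  assumes "B \<in> regular_bip n d"
  shows "(\<Sum>B'\<in>regular_bip n d. real (switch_count B B') * h B')
    = (\<Sum>p\<in>edge_pairs B. h (switch B (fst p) (snd p)))"
proof -
  let ?g = "\<lambda>p. switch B (fst p) (snd p)"
  have "(\<Sum>p\<in>edge_pairs B. h (?g p))
    = (\<Sum>B'\<in>regular_bip n d. \<Sum>p\<in>{p \<in> edge_pairs B. ?g p = B'}. h (?g p))"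
    using assms by (intro sum.group[symmetric] finite_edge_pairs finite_regular_bip)
      (auto intro: switch_regular regular_bip_finite)
  also have "\<dots> = (\<Sum>B'\<in>regular_bip n d. real (switch_count B B') * h B')"
    by (intro sum.cong refl) (simp add: switch_count_def)
  finally show ?thesis by simp
qed

text \<open>Stationarity of the uniform distribution: since \<open>switch_count\<close> is
  symmetric, switches may be counted by their result instead of their origin.\<close>

lemma sum_switch:
  fixes h :: "bgraph \<Rightarrow> real"
  shows "(\<Sum>B\<in>regular_bip n d. \<Sum>p\<in>edge_pairs B. h (switch B (fst p) (snd p)))
    = (\<Sum>B\<in>regular_bip n d. \<Sum>p\<in>edge_pairs B. h B)"
proof -
  let ?\<Omega> = "regular_bip n d"
  have "(\<Sum>B\<in>?\<Omega>. \<Sum>p\<in>edge_pairs B. h (switch B (fst p) (snd p)))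
    = (\<Sum>B'\<in>?\<Omega>. \<Sum>B\<in>?\<Omega>. real (switch_count B B') * h B')"
    by (subst sum.swap) (simp add: sum_switch_count)
  also have "\<dots> = (\<Sum>B'\<in>?\<Omega>. \<Sum>B\<in>?\<Omega>. (real (switch_count B' B) * 1) * h B')"
    by (intro sum.cong refl) (simp add: switch_count_sym regular_bip_finite)
  also have "\<dots> = (\<Sum>B'\<in>?\<Omega>. \<Sum>p\<in>edge_pairs B'. h B')"
  proof (intro sum.cong refl)
    fix B assume "B \<in> ?\<Omega>"
    then show "(\<Sum>B'\<in>?\<Omega>. (real (switch_count B B') * 1) * h B) = (\<Sum>p\<in>edge_pairs B. h B)"
      using sum_switch_count[of B n d "\<lambda>_. 1"] by (simp flip: sum_distrib_right)
  qed
  finally show ?thesis .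
qed

section \<open>Positivity and Dirichlet form of the lazy chain\<close>

locale switch_chain =
  fixes n d :: nat
  assumes two_edges: "2 \<le> d * n"
begin

abbreviation "\<Omega> \<equiv> regular_bip n d"

definition pairs :: real where
  "pairs = real (d * n) * (real (d * n) - 1)"

lemma pairs_pos: "0 < pairs"
proof -
  have "2 \<le> real (d * n)" using two_edges by linarith
  then show ?thesis unfolding pairs_def by (intro mult_pos_pos) linarith+
qed

lemma card_edge_pairs_regular:
  assumes "B \<in> \<Omega>" shows "real (card (edge_pairs B)) = pairs"
proof -
  have "real (d * n - 1) = real (d * n) - 1" using two_edges by (subst of_nat_diff) linarith+
  then show ?thesis
    unfolding card_edge_pairs[OF regular_bip_finite[OF assms]] card_regular_bip[OF assms] pairs_def
    by simp
qed

lemma switch_P_eq: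
  assumes "B \<in> \<Omega>"
  shows "switch_P B B' = (if B' = B then 1 / 2 else 0) + real (switch_count B B') / (2 * pairs)"
proof -
  have "edge_pairs B \<noteq> {}" using card_edge_pairs_regular[OF assms] pairs_pos by auto
  then show ?thesis
    by (simp add: switch_P_def card_edge_pairs_regular[OF assms] switch_count_def)
qed

lemma switch_P_sym: "B \<in> \<Omega> \<Longrightarrow> B' \<in> \<Omega> \<Longrightarrow> switch_P B B' = switch_P B' B"
  by (auto simp: switch_P_eq switch_count_sym regular_bip_finite)

lemma sum_switch_P:
  assumes "B \<in> \<Omega>"
  shows "(\<Sum>B'\<in>\<Omega>. switch_P B B' * h B')
    = h B / 2 + (\<Sum>p\<in>edge_pairs B. h (switch B (fst p) (snd p))) / (2 * pairs)"
proof -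
  have "(\<Sum>B'\<in>\<Omega>. switch_P B B' * h B')
    = (\<Sum>B'\<in>\<Omega>. (if B' = B then h B' / 2 else 0) + (real (switch_count B B') * h B') / (2 * pairs))"
    by (intro sum.cong refl) (simp add: switch_P_eq[OF assms] algebra_simps)
  also have "\<dots> = h B / 2 + (\<Sum>B'\<in>\<Omega>. real (switch_count B B') * h B') / (2 * pairs)"
    using assms finite_regular_bip by (simp add: sum.distrib sum.delta sum_divide_distrib)
  finally show ?thesis by (simp add: sum_switch_count[OF assms])
qed

lemma switch_P_rows: "B \<in> \<Omega> \<Longrightarrow> (\<Sum>B'\<in>\<Omega>. switch_P B B') = 1"
  using sum_switch_P[of B "\<lambda>_. 1"] pairs_pos by (simp add: card_edge_pairs_regular)

lemma sum_edge_pairs_const: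
  "(\<Sum>B\<in>\<Omega>. \<Sum>p\<in>edge_pairs B. (h B :: real)) = pairs * (\<Sum>B\<in>\<Omega>. h B)"
  by (simp add: sum_distrib_left card_edge_pairs_regular)

lemma form_eq:
  "(\<Sum>B\<in>\<Omega>. \<Sum>B'\<in>\<Omega>. g B * switch_P B B' * g B')
    = (\<Sum>B\<in>\<Omega>. (g B)\<^sup>2) / 2 + (\<Sum>B\<in>\<Omega>. \<Sum>p\<in>edge_pairs B. g B * g (switch B (fst p) (snd p))) / (2 * pairs)"
proof -
  have "(\<Sum>B\<in>\<Omega>. \<Sum>B'\<in>\<Omega>. g B * switch_P B B' * g B') = (\<Sum>B\<in>\<Omega>. g B * (\<Sum>B'\<in>\<Omega>. switch_P B B' * g B'))"
    by (simp add: sum_distrib_left mult.assoc)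
  also have "\<dots> = (\<Sum>B\<in>\<Omega>. (g B)\<^sup>2 / 2 + (\<Sum>p\<in>edge_pairs B. g B * g (switch B (fst p) (snd p))) / (2 * pairs))"
    by (intro sum.cong refl) (simp add: sum_switch_P power2_eq_square distrib_left sum_distrib_left)
  finally show ?thesis by (simp add: sum.distrib sum_divide_distrib)
qed

lemma sum_square_pm:
  assumes "s = 1 \<or> s = - 1"
  shows "(\<Sum>B\<in>\<Omega>. \<Sum>p\<in>edge_pairs B. (g B + s * g (switch B (fst p) (snd p)))\<^sup>2)
    = 2 * pairs * (\<Sum>B\<in>\<Omega>. (g B)\<^sup>2) + 2 * s * (\<Sum>B\<in>\<Omega>. \<Sum>p\<in>edge_pairs B. g B * g (switch B (fst p) (snd p)))"
proof -
  have s: "s * s = 1" using assms by auto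
  have "(g B + s * g B')\<^sup>2 = (g B)\<^sup>2 + (g B')\<^sup>2 + 2 * s * (g B * g B')" for B B'
    using assms by (auto simp: power2_eq_square algebra_simps)
  then have "(\<Sum>B\<in>\<Omega>. \<Sum>p\<in>edge_pairs B. (g B + s * g (switch B (fst p) (snd p)))\<^sup>2)
    = (\<Sum>B\<in>\<Omega>. \<Sum>p\<in>edge_pairs B. (g B)\<^sup>2) + (\<Sum>B\<in>\<Omega>. \<Sum>p\<in>edge_pairs B. (g (switch B (fst p) (snd p)))\<^sup>2)
      + 2 * s * (\<Sum>B\<in>\<Omega>. \<Sum>p\<in>edge_pairs B. g B * g (switch B (fst p) (snd p)))"
    by (simp only: sum.distrib sum_distrib_left)
  then show ?thesis
    using sum_switch[of "\<lambda>B. (g B)\<^sup>2" n d] sum_edge_pairs_const[of "\<lambda>B. (g B)\<^sup>2"] by simp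
qed

text \<open>Moving with probability only 1/2 makes the form a positive multiple of the sum of (g B +
  g B')^2 over all switches.\<close>

lemma switch_P_psd: "0 \<le> (\<Sum>B\<in>\<Omega>. \<Sum>B'\<in>\<Omega>. g B * switch_P B B' * g B')"
proof -
  have "0 \<le> (\<Sum>B\<in>\<Omega>. \<Sum>p\<in>edge_pairs B. (g B + 1 * g (switch B (fst p) (snd p)))\<^sup>2)"
    by (intro sum_nonneg) simp
  then show ?thesis
    unfolding form_eq sum_square_pm[OF disjI1[OF refl]] using pairs_pos by (simp add: field_simps)
qed

text \<open>The 4 combines the probability 1/2 of moving with the 1/2 in front of the squared
  differences.\<close>

lemma dirichlet_form:
  "(\<Sum>B\<in>\<Omega>. (g B)\<^sup>2) - (\<Sum>B\<in>\<Omega>. \<Sum>B'\<in>\<Omega>. g B * switch_P B B' * g B')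
    = (\<Sum>B\<in>\<Omega>. energy g B) / (4 * pairs)"
proof -
  have "(\<Sum>B\<in>\<Omega>. energy g B)
    = (\<Sum>B\<in>\<Omega>. \<Sum>p\<in>edge_pairs B. (g B + (- 1) * g (switch B (fst p) (snd p)))\<^sup>2)"
    by (simp add: energy_def)
  then have "(\<Sum>B\<in>\<Omega>. energy g B) = 2 * pairs * (\<Sum>B\<in>\<Omega>. (g B)\<^sup>2)
      - 2 * (\<Sum>B\<in>\<Omega>. \<Sum>p\<in>edge_pairs B. g B * g (switch B (fst p) (snd p)))"
    unfolding sum_square_pm[OF disjI2[OF refl]] by simp
  then show ?thesis
    unfolding form_eq using pairs_pos by (simp add: diff_divide_distrib)
qed

end

text \<open>A graph is determined by the neighbourhoods of the vertices in X, each of them a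
  d-subset of Y.\<close>

lemma card_regular_bip_le:
  "card (regular_bip n d) \<le> n ^ (d * n)"
proof -
  let ?F = "{A. A \<subseteq> {..<n} \<and> card A = d}"
  let ?g = "\<lambda>B. \<lambda>x\<in>{..<n}. {y. (x, y) \<in> B}"
  have "inj_on ?g (regular_bip n d)"
  proof (rule inj_onI, rule set_eqI)
    fix B B' and e :: "nat \<times> nat" assume *: "B \<in> regular_bip n d" "B' \<in> regular_bip n d" "?g B = ?g B'"
    obtain x y where e: "e = (x, y)" by force
    show "e \<in> B \<longleftrightarrow> e \<in> B'"
    proof (cases "x < n")
      case True
      then have "{y. (x, y) \<in> B} = {y. (x, y) \<in> B'}"
        using fun_cong[OF *(3), of x] by simp
      then show ?thesis by (auto simp: e)
    qed (use * e in \<open>auto simp: regular_bip_def\<close>)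
  qed
  moreover have "?g ` regular_bip n d \<subseteq> {..<n} \<rightarrow>\<^sub>E ?F"
    by (auto simp: regular_bip_def)
  moreover have fF: "finite ?F" by (rule finite_subset[of _ "Pow {..<n}"]) auto
  ultimately have "card (regular_bip n d) \<le> card ({..<n} \<rightarrow>\<^sub>E ?F)"
    by (intro card_inj_on_le) (auto intro: finite_PiE)
  also have "\<dots> = (n choose d) ^ n"
    using n_subsets[of "{..<n}" d] by (simp add: card_PiE)
  also have "\<dots> \<le> (n ^ d) ^ n"
    by (cases "d \<le> n") (auto intro!: power_mono binomial_le_pow simp: binomial_eq_0)
  finally show ?thesis by (simp add: power_mult)
qed

section \<open>Completing graphs with one missing edge at each of two vertices\<close>

text \<open>The \<open>of_bool\<close> is added on the left to avoid truncated subtraction. Here x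
  and y lie on different sides, so equal numbers may name different vertices.\<close>

definition deficit :: "nat \<Rightarrow> nat \<Rightarrow> nat \<Rightarrow> nat \<Rightarrow> bgraph set" where
  "deficit n d x y = {Z. Z \<subseteq> {..<n} \<times> {..<n} \<and>
    (\<forall>v<n. deg fst Z v + of_bool (v = x) = d \<and> deg snd Z v + of_bool (v = y) = d)}"

definition surplus :: "nat \<Rightarrow> nat \<Rightarrow> nat \<Rightarrow> nat \<Rightarrow> bgraph set" where
  "surplus n d x y = {L. L \<subseteq> {..<n} \<times> {..<n} \<and>
    (\<forall>v<n. deg fst L v = d + of_bool (v = x) \<and> deg snd L v = d + of_bool (v = y))}"

lemma finite_grid_subset: "B \<subseteq> {..<n} \<times> {..<n::nat} \<Longrightarrow> finite B"
  by (rule finite_subset) auto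

lemma finite_deficit: "finite (deficit n d x y)" and finite_surplus: "finite (surplus n d x y)"
  by (rule finite_subset[of _ "Pow ({..<n} \<times> {..<n})"]; auto simp: deficit_def surplus_def)+

lemma deficit_finite: "Z \<in> deficit n d x y \<Longrightarrow> finite Z"
  and surplus_finite: "L \<in> surplus n d x y \<Longrightarrow> finite L"
  by (auto simp: deficit_def surplus_def intro: finite_grid_subset)

lemma deficit_grid: "Z \<in> deficit n d x y \<Longrightarrow> (p, q) \<in> Z \<Longrightarrow> p < n \<and> q < n"
  by (auto simp: deficit_def)

lemma insert_deficit:
  assumes "Z \<in> deficit n d x y" "x < n" "y < n" "(x, y) \<notin> Z"
  shows "insert (x, y) Z \<in> regular_bip n d"
  using assms by (auto simp: deficit_def regular_bip_iff deg_insert finite_grid_subset)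

definition repair :: "bgraph \<Rightarrow> nat \<Rightarrow> nat \<Rightarrow> nat \<Rightarrow> nat \<Rightarrow> bgraph" where
  "repair Z x y p q = insert (x, q) (insert (p, y) (Z - {(p, q)}))"

text \<open>These are the edges pq that can be replaced by xq and py without creating a double edge;
  p \<noteq> x and q \<noteq> y follow.\<close>

definition repairs :: "bgraph \<Rightarrow> nat \<Rightarrow> nat \<Rightarrow> (nat \<times> nat) set" where
  "repairs Z x y = {(p, q). (p, q) \<in> Z \<and> (x, q) \<notin> Z \<and> (p, y) \<notin> Z}"

lemma repair_regular:
  assumes "Z \<in> deficit n d x y" "x < n" "y < n" "(p, q) \<in> repairs Z x y"
  shows "repair Z x y p q \<in> regular_bip n d"
proof -
  have fin: "finite Z" using assms(1) by (rule deficit_finite)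
  have r: "(p, q) \<in> Z" "(x, q) \<notin> Z" "(p, y) \<notin> Z" "p \<noteq> x"
    using assms(4) by (auto simp: repairs_def)
  have "deg k (repair Z x y p q) v + of_bool (v = k (p, q))
      = deg k Z v + of_bool (v = k (x, q)) + of_bool (v = k (p, y))" for k v
    using r fin deg_remove[of Z "(p, q)" k v] by (auto simp: deg_insert repair_def)
  from this[of fst] this[of snd]
  have "deg fst (repair Z x y p q) v = deg fst Z v + of_bool (v = x)"
    "deg snd (repair Z x y p q) v = deg snd Z v + of_bool (v = y)" for v
    by auto
  moreover have "repair Z x y p q \<subseteq> {..<n} \<times> {..<n}"
    using assms r(1) by (auto simp: repair_def deficit_def)
  ultimately show ?thesis using assms(1) by (simp add: deficit_def regular_bip_iff)
qed

lemma repair_undo: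
  assumes "(p, q) \<in> repairs Z x y"
  shows "Z = insert (p, q) (repair Z x y p q - {(x, q), (p, y)})"
  using assms by (auto simp: repairs_def repair_def)

text \<open>The two repairs are one switch apart: py and p'q are exchanged for pq and p'y.\<close>

lemma repair_energy_col:
  assumes "finite Z" "(p, q) \<in> repairs Z x y" "(p', q) \<in> repairs Z x y" "(x, y) \<in> Z"
  shows "(f (repair Z x y p q) - f (repair Z x y p' q))\<^sup>2 \<le> energy f (repair Z x y p q)"
proof (cases "p = p'")
  case False
  with assms have "switchable (repair Z x y p q) p y p' q"
    by (auto simp: switchable_def repair_def repairs_def)
  then show ?thesis
    by (rule switch_le_energy[rotated]) (use assms False in \<open>auto simp: repair_def repairs_def\<close>)
qed (simp add: energy_nonneg)

lemma repair_energy_row: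
  assumes "finite Z" "(p, q) \<in> repairs Z x y" "(p, q') \<in> repairs Z x y" "(x, y) \<in> Z"
  shows "(f (repair Z x y p q) - f (repair Z x y p q'))\<^sup>2 \<le> energy f (repair Z x y p q)"
proof (cases "q = q'")
  case False
  with assms have "switchable (repair Z x y p q) x q p q'"
    by (auto simp: switchable_def repair_def repairs_def)
  then show ?thesis
    by (rule switch_le_energy[rotated]) (use assms False in \<open>auto simp: repair_def repairs_def\<close>)
qed (simp add: energy_nonneg)

lemma square_diff_via:
  fixes a b c :: real shows "(a - b)\<^sup>2 \<le> 2 * ((a - c)\<^sup>2 + (b - c)\<^sup>2)"
proof -
  have "2 * ((a - c)\<^sup>2 + (b - c)\<^sup>2) - (a - b)\<^sup>2 = (a + b - 2 * c)\<^sup>2"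
    by (simp add: power2_eq_square algebra_simps)
  then show ?thesis by (metis diff_ge_0_iff_ge zero_le_power2)
qed

text \<open>Two repairs have a common neighbour C, possibly equal to one of them. Only the energies
  at the two repairs are charged, never the energy at C, because only repairs are counted
  later.\<close>

lemma repair_energy:
  assumes fin: "finite Z" and r: "(p, q) \<in> repairs Z x y" "(p', q') \<in> repairs Z x y" and xy: "(x, y) \<in> Z"
  shows "(f (repair Z x y p q) - f (repair Z x y p' q'))\<^sup>2
    \<le> 2 * (energy f (repair Z x y p q) + energy f (repair Z x y p' q'))"
proof -
  let ?R = "repair Z x y"
  have "\<exists>C. (f (?R p q) - f C)\<^sup>2 \<le> energy f (?R p q) \<and> (f (?R p' q') - f C)\<^sup>2 \<le> energy f (?R p' q')"
  proof (cases "(p, q') \<in> Z \<or> (p', q) \<in> Z")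
    \<comment> \<open>A corner pq' or p'q that is an edge of Z is itself a repair; it shares a row
      with one given repair and a column with the other.\<close>
    case True
    then have "(p, q') \<in> repairs Z x y \<or> (p', q) \<in> repairs Z x y"
      using r by (auto simp: repairs_def)
    then show ?thesis
      using repair_energy_row[OF fin] repair_energy_col[OF fin] r xy by metis
  next
    \<comment> \<open>C is Z without pq and p'q', but with py, xq' and p'q; it is one switch away
      from either repair.\<close>
    case False
    define C where "C = insert (x, q') (insert (p', q) (?R p q - {(x, q)} - {(p', q')}))"
    have ne: "p \<noteq> p'" "q \<noteq> q'" using False r by (auto simp: repairs_def)
    have s: "switchable (?R p q) x q p' q'" "switchable (?R p' q') p' y p q"
      using False r xy ne by (auto simp: switchable_def repair_def repairs_def)
    have "C = insert (p', q) (insert (p, y) (?R p' q' - {(p', y)} - {(p, q)}))"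
      using False r xy ne by (auto simp: C_def repair_def repairs_def)
    then show ?thesis
      using switch_le_energy[OF _ s(1) C_def] switch_le_energy[OF _ s(2)] fin
      by (auto simp: repair_def)
  qed
  then obtain C where "(f (?R p q) - f C)\<^sup>2 \<le> energy f (?R p q)" "(f (?R p' q') - f C)\<^sup>2 \<le> energy f (?R p' q')"
    by blast
  then show ?thesis using square_diff_via[of "f (?R p q)" "f (?R p' q')" "f C"] by argo
qed

text \<open>The choice is arbitrary if there is no repair; this case is never used.\<close>

definition fill :: "bgraph \<Rightarrow> nat \<Rightarrow> nat \<Rightarrow> bgraph" where
  "fill Z x y = (if (x, y) \<in> Z
    then (let (p, q) = SOME e. e \<in> repairs Z x y in repair Z x y p q)
    else insert (x, y) Z)"

lemma fill_repair:
  assumes "(x, y) \<in> Z" "repairs Z x y \<noteq> {}"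
  obtains p q where "(p, q) \<in> repairs Z x y" "fill Z x y = repair Z x y p q"
proof -
  obtain p q where pq: "(SOME e. e \<in> repairs Z x y) = (p, q)"
    by (metis surj_pair)
  have "(p, q) \<in> repairs Z x y" using assms(2) unfolding pq[symmetric] some_in_eq .
  then show ?thesis by (rule that) (simp add: fill_def assms(1) pq)
qed

text \<open>A site consists of the two deficient vertices, the deficient graph and one marked edge.
  The edge is read as a repair in \<open>crowded\<close> and as the edge to be removed in
  \<open>moves\<close>.\<close>

type_synonym site = "(nat \<times> nat) \<times> bgraph \<times> (nat \<times> nat)"

definition crowded :: "nat \<Rightarrow> nat \<Rightarrow> site set" where
  "crowded n d = {((x, y), Z, (p, q)) | x y Z p q. x < n \<and> y < n \<and> Z \<in> deficit n d x y
    \<and> (x, y) \<in> Z \<and> (p, q) \<in> repairs Z x y}"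

text \<open>One step along a trail: uw gives way to uy, so that the deficient vertex in Y passes
  from y to w while x stays.\<close>

definition moves :: "nat \<Rightarrow> nat \<Rightarrow> site set" where
  "moves n d = {((x, y), Z, (u, w)) | x y Z u w. x < n \<and> y < n \<and> Z \<in> deficit n d x y
    \<and> (u, w) \<in> Z \<and> (u, y) \<notin> Z}"

lemma finite_sites:
  "finite {((x, y), Z, (p, q)) | x y Z p q. x < n \<and> y < n \<and> Z \<in> deficit n d x y \<and> (p, q) \<in> Z}"
  by (rule finite_subset[of _ "({..<n} \<times> {..<n}) \<times> Pow ({..<n} \<times> {..<n}) \<times> ({..<n} \<times> {..<n})"])
    (auto simp: deficit_def)

lemma finite_crowded: "finite (crowded n d)" and finite_moves: "finite (moves n d)"
  by (rule finite_subset[OF _ finite_sites[of n d]]; auto simp: crowded_def moves_def repairs_def)+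

lemma sum_fibre_le:
  fixes h :: "'b \<Rightarrow> real"
  assumes "finite D" "finite T" "g ` D \<subseteq> T" "\<And>b. b \<in> T \<Longrightarrow> 0 \<le> h b"
    and "\<And>b. b \<in> T \<Longrightarrow> card {a \<in> D. g a = b} \<le> K"
  shows "(\<Sum>a\<in>D. h (g a)) \<le> real K * (\<Sum>b\<in>T. h b)"
proof -
  have "(\<Sum>a\<in>D. h (g a)) = (\<Sum>b\<in>T. \<Sum>a\<in>{a \<in> D. g a = b}. h (g a))"
    using assms by (intro sum.group[symmetric])
  also have "\<dots> \<le> (\<Sum>b\<in>T. real K * h b)"
    using assms by (intro sum_mono) (simp add: mult_right_mono)
  finally show ?thesis by (simp add: sum_distrib_left)
qed

lemma sum_inj_le:
  fixes h :: "'b \<Rightarrow> real"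
  assumes "inj_on g D" "finite T" "g ` D \<subseteq> T" "\<And>b. b \<in> T \<Longrightarrow> 0 \<le> h b"
  shows "(\<Sum>a\<in>D. h (g a)) \<le> (\<Sum>b\<in>T. h b)"
  proof -
  have "(\<Sum>a\<in>D. h (g a)) = (\<Sum>b\<in>g ` D. h b)" by (simp add: sum.reindex[OF assms(1)])
  also have "\<dots> \<le> (\<Sum>b\<in>T. h b)" by (rule sum_mono2) (use assms in auto)
  finally show ?thesis .
qed

lemma card_row_le: "Z \<in> deficit n d x y \<Longrightarrow> card {w. (u, w) \<in> Z} \<le> d"
proof (cases "u < n")
  case False
  assume "Z \<in> deficit n d x y"
  then have "{w. (u, w) \<in> Z} = {}" using False by (auto simp: deficit_def)
  then show ?thesis by simp
qed (auto simp: deficit_def deg_fst[symmetric])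

text \<open>In the repaired graph B the pair xy is still an edge, q is a neighbour of x and p a
  neighbour of y. This leaves n d choices of xy and d choices each of q and p, and these data
  recover Z by undoing the repair.\<close>

lemma sum_energy_repair_le:
  "(\<Sum>((x, y), Z, (p, q))\<in>crowded n d. energy f (repair Z x y p q))
    \<le> real (n * d ^ 3) * (\<Sum>B\<in>regular_bip n d. energy f B)"
proof -
  let ?g = "\<lambda>((x, y), Z, (p, q)). repair Z x y p q"
  have "card {t \<in> crowded n d. ?g t = B} \<le> n * d ^ 3" if B: "B \<in> regular_bip n d" for B
  proof -
    let ?T = "SIGMA e:B. {q. (fst e, q) \<in> B} \<times> {p. (p, snd e) \<in> B}"
    let ?h = "\<lambda>((x, y), Z :: bgraph, (p, q)). ((x, y), (q, p))"
    have fin: "finite {q. (x, q) \<in> B}" "finite {p. (p, x) \<in> B}" for x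
      by (rule finite_subset[of _ "{..<n}"]; use B in \<open>auto simp: regular_bip_def\<close>)+
    have "card ?T = (\<Sum>e\<in>B. d * d)"
    proof -
      have "card ({q. (fst e, q) \<in> B} \<times> {p. (p, snd e) \<in> B}) = d * d" if "e \<in> B" for e
        using that B by (cases e) (auto simp: card_cartesian_product regular_bip_def)
      then show ?thesis by (simp add: card_SigmaI regular_bip_finite[OF B] fin)
    qed
    then have T: "card ?T = n * d ^ 3"
      by (simp add: card_regular_bip[OF B] power3_eq_cube)
    have undo: "fst (snd t) = (\<lambda>((x, y), (q, p)). insert (p, q) (B - {(x, q), (p, y)})) (?h t)"
      if mem: "t \<in> {t \<in> crowded n d. ?g t = B}" for t
    proof -
      obtain x y Z p q where t: "t = ((x, y), Z, (p, q))" "repair Z x y p q = B" "(p, q) \<in> repairs Z x y"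
        using mem by (auto simp: crowded_def)
      show ?thesis unfolding t(1) prod.case fst_conv snd_conv t(2)[symmetric] by (rule repair_undo[OF t(3)])
    qed
    have "inj_on ?h {t \<in> crowded n d. ?g t = B}"
    proof (rule inj_onI)
      fix s t assume *: "s \<in> {t \<in> crowded n d. ?g t = B}" "t \<in> {t \<in> crowded n d. ?g t = B}" "?h s = ?h t"
      then have "fst (snd s) = fst (snd t)" by (simp only: undo)
      then show "s = t" using *(3) by (cases s; cases t) auto
    qed
    moreover have "?h ` {t \<in> crowded n d. ?g t = B} \<subseteq> ?T"
      by (auto simp: crowded_def repair_def repairs_def)
    moreover have "finite ?T" using regular_bip_finite[OF B] fin by (intro finite_SigmaI finite_cartesian_product)
    ultimately show ?thesis unfolding T[symmetric] by (rule card_inj_on_le)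
  qed
  moreover have "?g ` crowded n d \<subseteq> regular_bip n d"
    by (auto simp: crowded_def intro: repair_regular)
  ultimately show ?thesis
    using sum_fibre_le[OF finite_crowded finite_regular_bip, of ?g n d n d "energy f" "n * d ^ 3"] energy_nonneg
    by (simp add: case_prod_unfold)
qed

lemma card_repairs_le:
  assumes "Z \<in> deficit n d x y" shows "card (repairs Z x y) \<le> d * n"
proof -
  have "card (repairs Z x y) \<le> card Z"
    using assms by (intro card_mono deficit_finite) (auto simp: repairs_def)
  also have "card Z = (\<Sum>v<n. deg fst Z v)"
    using assms by (intro card_eq_sum_deg deficit_finite) (auto simp: deficit_def)
  also have "\<dots> \<le> (\<Sum>v<n. d)"
    using assms by (intro sum_mono) (auto simp: deficit_def)
  finally show ?thesis by (simp add: mult.commute)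
qed

lemma sum_Sigma:
  assumes "finite A" "\<And>a. a \<in> A \<Longrightarrow> finite (B a)"
  shows "(\<Sum>t\<in>Sigma A B. h t) = (\<Sum>a\<in>A. \<Sum>b\<in>B a. h (a, b))"
  using assms by (subst sum.Sigma) auto

definition detour :: "(bgraph \<Rightarrow> real) \<Rightarrow> site \<Rightarrow> real" where
  "detour f = (\<lambda>((x, y), Z, (p, q)). (f (fill Z x y) - f (repair Z x y p q))\<^sup>2)"

lemma sum_crowded:
  "(\<Sum>t\<in>crowded n d. h t) = (\<Sum>x<n. \<Sum>y<n. \<Sum>Z\<in>{Z \<in> deficit n d x y. (x, y) \<in> Z}.
      \<Sum>(p, q)\<in>repairs Z x y. h ((x, y), Z, (p, q)))"
proof -
  have fin: "finite (repairs Z x y)" if "Z \<in> deficit n d x y" for Z x y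
    using deficit_finite[OF that] by (rule finite_subset[rotated]) (auto simp: repairs_def)
  let ?D = "\<lambda>e. {Z \<in> deficit n d (fst e) (snd e). e \<in> Z}"
  have eq: "crowded n d = (SIGMA e:{..<n} \<times> {..<n}. SIGMA Z:?D e. repairs Z (fst e) (snd e))"
    by (auto simp: crowded_def)
  have "(\<Sum>t\<in>crowded n d. h t)
      = (\<Sum>e\<in>{..<n} \<times> {..<n}. \<Sum>s\<in>(SIGMA Z:?D e. repairs Z (fst e) (snd e)). h (e, s))"
    unfolding eq by (rule sum_Sigma) (auto intro!: finite_SigmaI fin simp: finite_deficit)
  also have "\<dots> = (\<Sum>e\<in>{..<n} \<times> {..<n}. \<Sum>Z\<in>?D e. \<Sum>r\<in>repairs Z (fst e) (snd e). h (e, Z, r))"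
    by (intro sum.cong refl sum_Sigma) (auto intro!: fin simp: finite_deficit)
  finally show ?thesis by (simp add: sum.cartesian_product case_prod_unfold)
qed

text \<open>For d = 1 the vertex x has no edge in Z at all, so xy is always free.\<close>

lemma crowded_empty: "crowded n 1 = {}"
proof -
  have False if "Z \<in> deficit n 1 x y" "x < n" "(x, y) \<in> Z" for Z x y
  proof -
    have "deg fst Z x = 0" using that(1,2) by (auto simp: deficit_def)
    then have "{e \<in> Z. fst e = x} = {}"
      using deficit_finite[OF that(1)] by (simp only: deg_def card_eq_0_iff finite_Collect_conjI) auto
    then show False using that(3) by force
  qed
  then show ?thesis by (auto simp: crowded_def)
qed

text \<open>Both ends of a detour are repairs of the same Z, so it costs twice the sum of their
  energies. The energy at \<open>fill\<close> recurs once for each repair of Z, at most d n times,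
  which together with the repair itself gives 1 + d n.\<close>

lemma sum_detour_le:
  "(\<Sum>t\<in>crowded n d. detour f t)
    \<le> real (d - 1) * (2 * (1 + real (d * n)) * real (n * d ^ 3)) * (\<Sum>B\<in>regular_bip n d. energy f B)"
proof -
  define S where "S = (\<Sum>B\<in>regular_bip n d. energy f B)"
  define E where "E = (\<lambda>((x, y), Z, (p, q)). energy f (repair Z x y p q))"
  define F where "F = (\<lambda>((x, y), Z, _ :: nat \<times> nat). energy f (fill Z x y))"
  have S0: "0 \<le> S" unfolding S_def by (intro sum_nonneg energy_nonneg)
  have Ele: "(\<Sum>t\<in>crowded n d. E t) \<le> real (n * d ^ 3) * S"
    using sum_energy_repair_le[where f = f] by (simp add: E_def S_def case_prod_unfold)
  have "(\<Sum>_\<in>repairs Z x y. energy f (fill Z x y))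
      \<le> real (d * n) * (\<Sum>(p, q)\<in>repairs Z x y. energy f (repair Z x y p q))"
    if Z: "Z \<in> deficit n d x y" and xy: "(x, y) \<in> Z" for x y Z
  proof (cases "repairs Z x y = {}")
    case False
    obtain p q where pq: "(p, q) \<in> repairs Z x y" "fill Z x y = repair Z x y p q"
      using fill_repair[OF xy False] .
    have fin: "finite (repairs Z x y)"
      using deficit_finite[OF Z] by (rule finite_subset[rotated]) (auto simp: repairs_def)
    have "energy f (repair Z x y p q) \<le> (\<Sum>(p, q)\<in>repairs Z x y. energy f (repair Z x y p q))"
      using member_le_sum[OF pq(1), of "\<lambda>(p, q). energy f (repair Z x y p q)"] fin
      by (auto simp: energy_nonneg)
    then show ?thesis
      using card_repairs_le[OF Z] unfolding pq(2)
      by (simp add: mult_mono energy_nonneg del: of_nat_mult)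
  qed simp
  then have "(\<Sum>x<n. \<Sum>y<n. \<Sum>Z\<in>{Z \<in> deficit n d x y. (x, y) \<in> Z}. \<Sum>_\<in>repairs Z x y. energy f (fill Z x y))
      \<le> (\<Sum>x<n. \<Sum>y<n. \<Sum>Z\<in>{Z \<in> deficit n d x y. (x, y) \<in> Z}.
        real (d * n) * (\<Sum>(p, q)\<in>repairs Z x y. energy f (repair Z x y p q)))"
    by (intro sum_mono) blast
  then have "(\<Sum>t\<in>crowded n d. F t) \<le> real (d * n) * (\<Sum>t\<in>crowded n d. E t)"
    unfolding sum_crowded F_def E_def prod.case
    by (simp only: sum_distrib_left[symmetric] case_prod_unfold)
  then have FE: "(\<Sum>t\<in>crowded n d. F t) \<le> real (d * n) * (real (n * d ^ 3) * S)"
    using mult_left_mono[OF Ele, of "real (d * n)"] by simp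
  have "detour f t \<le> 2 * (F t + E t)" if t: "t \<in> crowded n d" for t
  proof -
    obtain x y Z p q where t: "t = ((x, y), Z, (p, q))" "Z \<in> deficit n d x y"
        "(x, y) \<in> Z" "(p, q) \<in> repairs Z x y"
      using t by (auto simp: crowded_def)
    then have "repairs Z x y \<noteq> {}" by auto
    from fill_repair[OF t(3) this] obtain p' q' where
      "(p', q') \<in> repairs Z x y" "fill Z x y = repair Z x y p' q'" .
    then show ?thesis
      using repair_energy[OF deficit_finite[OF t(2)] _ t(4,3)] by (simp add: t(1) detour_def F_def E_def)
  qed
  then have "(\<Sum>t\<in>crowded n d. detour f t) \<le> (\<Sum>t\<in>crowded n d. 2 * (F t + E t))"
    by (rule sum_mono)
  also have "\<dots> = 2 * ((\<Sum>t\<in>crowded n d. F t) + (\<Sum>t\<in>crowded n d. E t))"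
    by (simp add: sum.distrib sum_distrib_left)
  also have "\<dots> \<le> 2 * (real (d * n) * (real (n * d ^ 3) * S) + real (n * d ^ 3) * S)"
    using FE Ele by simp
  finally have le: "(\<Sum>t\<in>crowded n d. detour f t) \<le> 2 * (1 + real (d * n)) * real (n * d ^ 3) * S"
    by (simp add: algebra_simps)
  show ?thesis
  \<comment> \<open>The factor d - 1 is at least 1 for d >= 2 and records that there are no detours
    for d = 1. Without it the final estimate for d = 1 would exceed 32 n^6 for large n.\<close>
  proof (cases "d \<le> 1")
    case True
    then show ?thesis using crowded_empty[of n] le by (cases "d = 0") (auto simp: S_def le_Suc_eq)
  next
    case False
    have "1 * (2 * (1 + real (d * n)) * real (n * d ^ 3) * S)
        \<le> real (d - 1) * (2 * (1 + real (d * n)) * real (n * d ^ 3) * S)"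
      using False S0 by (intro mult_right_mono) auto
    then show ?thesis using le by (simp add: S_def mult.assoc)
  qed
qed

section \<open>The cost of a single move\<close>

definition slide :: "site \<Rightarrow> site" where
  "slide = (\<lambda>((x, y), Z, (u, w)). ((x, w), insert (u, y) (Z - {(u, w)}), (u, y)))"

definition jump :: "(bgraph \<Rightarrow> real) \<Rightarrow> site \<Rightarrow> real" where
  "jump f = (\<lambda>((x, y), Z, (u, w)).
    (f (fill Z x y) - f (fill (insert (u, y) (Z - {(u, w)})) x w))\<^sup>2)"

text \<open>\<open>slide\<close> sends a move to the reverse move, which removes uy, restores uw and
  brings the deficiency back from w to y.\<close>

lemma slide_slide: "t \<in> moves n d \<Longrightarrow> slide (slide t) = t"
  by (auto simp: slide_def moves_def)

lemma slide_deficit: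
  assumes "((x, y), Z, (u, w)) \<in> moves n d"
  shows "insert (u, y) (Z - {(u, w)}) \<in> deficit n d x w"
proof -
  have Z: "Z \<in> deficit n d x y" "(u, w) \<in> Z" "(u, y) \<notin> Z" "y < n"
    using assms by (auto simp: moves_def)
  have "deg k (insert (u, y) (Z - {(u, w)})) v + of_bool (v = k (u, w))
      = deg k Z v + of_bool (v = k (u, y))" for k v
    using Z deficit_finite[OF Z(1)] deg_remove[of Z "(u, w)" k v] by (auto simp: deg_insert)
  from this[of fst] this[of snd]
  have "deg fst (insert (u, y) (Z - {(u, w)})) v = deg fst Z v"
    "deg snd (insert (u, y) (Z - {(u, w)})) v + of_bool (v = w) = deg snd Z v + of_bool (v = y)" for v
    by auto
  then show ?thesis using Z by (auto simp: deficit_def)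
qed

lemma finite_row: "Z \<in> deficit n d x y \<Longrightarrow> finite {w. (u, w) \<in> Z}"
  by (rule finite_subset[of _ "{..<n}"]) (auto simp: deficit_def)

text \<open>In Z the vertex u has d neighbours but x only d - 1.\<close>

lemma exists_repair:
  assumes "Z \<in> deficit n d x y" "x < n" "u < n" "u \<noteq> x"
  shows "\<exists>q. (u, q) \<in> Z \<and> (x, q) \<notin> Z"
proof (rule ccontr)
  assume "\<not> ?thesis"
  then have "{q. (u, q) \<in> Z} \<subseteq> {q. (x, q) \<in> Z}" by auto
  then have "deg fst Z u \<le> deg fst Z x"
    unfolding deg_fst using finite_row[OF assms(1)] by (intro card_mono)
  moreover have "deg fst Z u + of_bool (u = x) = d" "deg fst Z x + of_bool (x = x) = d"
    using assms unfolding deficit_def by blast+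
  ultimately show False using assms(4) by simp
qed

text \<open>If both \<open>(x, y)\<close> and \<open>(x, w)\<close> are edges, the graphs before and after a move have the
  common repair \<open>(u, q)\<close>, and it leads to the same regular graph.\<close>

definition shared :: "site \<Rightarrow> site" where
  "shared = (\<lambda>((x, y), Z, (u, w)). ((x, y), Z, (u, SOME q. (u, q) \<in> Z \<and> (x, q) \<notin> Z)))"

text \<open>Passing to \<open>shared\<close> forgets only w, which is one of the at most d
  neighbours of u in Z.\<close>

lemma sum_shared_le:
  assumes "D \<subseteq> moves n d" "shared ` D \<subseteq> crowded n d"
  shows "(\<Sum>t\<in>D. detour f (shared t)) \<le> real d * (\<Sum>t\<in>crowded n d. detour f t)"
proof (rule sum_fibre_le[OF finite_subset[OF assms(1) finite_moves] finite_crowded assms(2)])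
  fix s assume "s \<in> crowded n d"
  then obtain x y Z p q where s: "s = ((x, y), Z, (p, q))" "Z \<in> deficit n d x y"
    by (auto simp: crowded_def)
  have "{t \<in> D. shared t = s} \<subseteq> (\<lambda>w. ((x, y), Z, (p, w))) ` {w. (p, w) \<in> Z}"
    using assms(1) by (auto simp: shared_def moves_def s(1))
  from card_mono[OF finite_imageI[OF finite_row[OF s(2)]] this]
  have "card {t \<in> D. shared t = s} \<le> card {w. (p, w) \<in> Z}"
    by (rule le_trans) (rule card_image_le[OF finite_row[OF s(2)]])
  then show "card {t \<in> D. shared t = s} \<le> d"
    using card_row_le[OF s(2), of p] by linarith
qed (auto simp: detour_def case_prod_unfold)

text \<open>Whether xy and xw are edges of Z decides whether the completions before and after the
  move need a repair. In \<open>T a b\<close> the two flags record these two facts.\<close>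

lemma sum_jump_le:
  "(\<Sum>t\<in>moves n d. jump f t) \<le> (\<Sum>B\<in>regular_bip n d. energy f B)
    + (2 + 4 * real d) * (\<Sum>t\<in>crowded n d. detour f t)"
proof -
  let ?P = "\<lambda>a b t. case t of ((x, y), Z, (u, w)) \<Rightarrow> u \<noteq> x \<and> ((x, y) \<in> Z \<longleftrightarrow> a) \<and> ((x, w) \<in> Z \<longleftrightarrow> b)"
  define T where "T = (\<lambda>a b. {t \<in> moves n d. ?P a b t})"
  define T0 where "T0 = {t \<in> moves n d. case t of ((x, y), Z, (u, w)) \<Rightarrow> u = x}"
  define S where "S = (\<Sum>B\<in>regular_bip n d. energy f B)"
  define V where "V = (\<Sum>t\<in>crowded n d. detour f t)"
  have fin: "finite (T a b)" "finite T0" for a b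
    using finite_moves[of n d] by (auto simp: T_def T0_def)
  have mv: "moves n d = T0 \<union> (T False False \<union> (T False True \<union> (T True False \<union> T True True)))"
    by (auto simp: T_def T0_def)
  have disj: "T0 \<inter> (T False False \<union> (T False True \<union> (T True False \<union> T True True))) = {}"
    "T False False \<inter> (T False True \<union> (T True False \<union> T True True)) = {}"
    "T False True \<inter> (T True False \<union> T True True) = {}" "T True False \<inter> T True True = {}"
    by (auto simp: T_def T0_def)
  have split: "(\<Sum>t\<in>moves n d. jump f t) = (\<Sum>t\<in>T0. jump f t) + ((\<Sum>t\<in>T False False. jump f t)
    + ((\<Sum>t\<in>T False True. jump f t) + ((\<Sum>t\<in>T True False. jump f t) + (\<Sum>t\<in>T True True. jump f t))))"
    unfolding mv by (simp only: sum.union_disjoint[OF _ _ disj(1)] sum.union_disjoint[OF _ _ disj(2)]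
      sum.union_disjoint[OF _ _ disj(3)] sum.union_disjoint[OF _ _ disj(4)] finite_Un fin simp_thms)
  have nn: "0 \<le> detour f t" for t by (simp add: detour_def case_prod_unfold)

  \<comment> \<open>If u = x, the move replaces xw by xy, and both completions are Z with xy
    added.\<close>
  have "jump f t = 0" if "t \<in> T0" for t
    using that by (auto simp: T0_def moves_def jump_def fill_def insert_commute insert_absorb)
  then have s0: "(\<Sum>t\<in>T0. jump f t) = 0" by simp

  \<comment> \<open>No repair on either side: the two completions differ by the switch of xy with
    uw, so the jump is a single term of the energy.\<close>
  let ?g = "\<lambda>((x, y), Z, (u, w)). (insert (x, y) Z, ((x, y), (u, w)))"
  let ?h = "\<lambda>(B, p). (f B - f (switch B (fst p) (snd p)))\<^sup>2"
  have g: "?g t \<in> Sigma (regular_bip n d) edge_pairs \<and> jump f t = ?h (?g t)" if t: "t \<in> T False False" for t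
  proof -
    obtain x y Z u w where t': "t = ((x, y), Z, (u, w))" "x < n" "y < n" "Z \<in> deficit n d x y"
        "(u, w) \<in> Z" "(u, y) \<notin> Z" "u \<noteq> x" "(x, y) \<notin> Z" "(x, w) \<notin> Z"
      using t by (auto simp: T_def moves_def)
    have "w \<noteq> y" using t' by auto
    then have s: "switchable (insert (x, y) Z) x y u w" using t' by (auto simp: switchable_def)
    have "fill (insert (u, y) (Z - {(u, w)})) x w = switch (insert (x, y) Z) (x, y) (u, w)"
      unfolding switch_switchable[OF s] using t' \<open>w \<noteq> y\<close> by (auto simp: fill_def)
    then have "jump f t = ?h (?g t)" using t' by (simp add: jump_def fill_def)
    moreover have "((x, y), (u, w)) \<in> edge_pairs (insert (x, y) Z)"
      using t' by (auto simp: edge_pairs_def)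
    ultimately show ?thesis using insert_deficit[OF t'(4,2,3,8)] t' by simp
  qed
  have "inj_on ?g (T False False)"
    by (rule inj_on_inverseI[of _ "\<lambda>(B, (e, p)). (e, B - {e}, p)"]) (auto simp: T_def moves_def)
  then have "(\<Sum>t\<in>T False False. ?h (?g t)) \<le> (\<Sum>r\<in>Sigma (regular_bip n d) edge_pairs. ?h r)"
    using g by (intro sum_inj_le finite_SigmaI finite_regular_bip finite_edge_pairs)
      (auto intro: regular_bip_finite)
  also have "\<dots> = S"
    unfolding S_def energy_def by (subst sum.Sigma)
      (auto intro: finite_edge_pairs finite_regular_bip regular_bip_finite)
  finally have s1: "(\<Sum>t\<in>T False False. jump f t) \<le> S" using g by simp

  \<comment> \<open>A repair is needed only before the move; the completion afterwards is the repair
    of Z at uw.\<close>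
  have g: "t \<in> crowded n d \<and> jump f t = detour f t" if t: "t \<in> T True False" for t
  proof -
    obtain x y Z u w where t': "t = ((x, y), Z, (u, w))" "x < n" "y < n" "Z \<in> deficit n d x y"
        "(u, w) \<in> Z" "(u, y) \<notin> Z" "u \<noteq> x" "(x, y) \<in> Z" "(x, w) \<notin> Z"
      using t by (auto simp: T_def moves_def)
    then have "fill (insert (u, y) (Z - {(u, w)})) x w = repair Z x y u w"
      by (auto simp: fill_def repair_def)
    then show ?thesis using t' by (auto simp: jump_def detour_def crowded_def repairs_def)
  qed
  then have "(\<Sum>t\<in>T True False. jump f t) = (\<Sum>t\<in>T True False. detour f t)"
    by (intro sum.cong) auto
  also have "\<dots> \<le> V"
    unfolding V_def using g nn by (intro sum_mono2 finite_crowded) blast+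
  finally have s2: "(\<Sum>t\<in>T True False. jump f t) \<le> V" .

  \<comment> \<open>The same situation with the move reversed.\<close>
  have g: "slide t \<in> crowded n d \<and> jump f t = detour f (slide t)" if t: "t \<in> T False True" for t
  proof -
    obtain x y Z u w where t': "t = ((x, y), Z, (u, w))" "x < n" "y < n" "Z \<in> deficit n d x y"
        "(u, w) \<in> Z" "(u, y) \<notin> Z" "u \<noteq> x" "(x, y) \<notin> Z" "(x, w) \<in> Z" and m: "t \<in> moves n d"
      using t by (auto simp: T_def moves_def)
    let ?Z = "insert (u, y) (Z - {(u, w)})"
    have "w < n" using t' deficit_grid by blast
    moreover have "?Z \<in> deficit n d x w" using slide_deficit m by (simp add: t'(1))
    moreover have "fill Z x y = repair ?Z x w u y"
      using t' by (auto simp: fill_def repair_def)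
    ultimately show ?thesis
      using t' by (auto simp: jump_def detour_def crowded_def repairs_def slide_def power2_commute)
  qed
  have "inj_on slide (T False True)"
    by (rule inj_on_inverseI[of _ slide]) (auto simp: T_def slide_slide)
  then have "(\<Sum>t\<in>T False True. detour f (slide t)) \<le> V"
    unfolding V_def using g nn by (intro sum_inj_le finite_crowded) auto
  then have s3: "(\<Sum>t\<in>T False True. jump f t) \<le> V" using g by simp

  \<comment> \<open>Repairs are needed on both sides. The jump splits into two detours to the shared
    repair; the square of the sum costs a factor 2 and each detour serves at most d moves, in total
    4 d.\<close>
  have g: "shared t \<in> crowded n d \<and> shared (slide t) \<in> crowded n d
      \<and> jump f t \<le> 2 * (detour f (shared t) + detour f (shared (slide t)))
      \<and> slide t \<in> moves n d" if t: "t \<in> T True True" for t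
  proof -
    obtain x y Z u w where t': "t = ((x, y), Z, (u, w))" "x < n" "y < n" "Z \<in> deficit n d x y"
        "(u, w) \<in> Z" "(u, y) \<notin> Z" "u \<noteq> x" "(x, y) \<in> Z" "(x, w) \<in> Z" and m: "t \<in> moves n d"
      using t by (auto simp: T_def moves_def)
    let ?Z = "insert (u, y) (Z - {(u, w)})"
    have uw: "u < n" "w < n" using t' deficit_grid by blast+
    have Z': "?Z \<in> deficit n d x w" using slide_deficit m by (simp add: t'(1))
    have eq: "((u, q) \<in> ?Z \<and> (x, q) \<notin> ?Z) \<longleftrightarrow> ((u, q) \<in> Z \<and> (x, q) \<notin> Z)" for q
      using t' by auto
    define q where "q = (SOME q. (u, q) \<in> Z \<and> (x, q) \<notin> Z)"
    have q: "(u, q) \<in> Z" "(x, q) \<notin> Z"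
      using someI_ex[OF exists_repair[OF t'(4,2) uw(1) t'(7)]] by (auto simp: q_def)
    have sh: "shared t = ((x, y), Z, (u, q))" "shared (slide t) = ((x, w), ?Z, (u, q))"
      unfolding shared_def slide_def t'(1) prod.case eq q_def by simp_all
    have "repair ?Z x w u q = repair Z x y u q"
      using t' q by (auto simp: repair_def)
    then have "jump f t \<le> 2 * (detour f (shared t) + detour f (shared (slide t)))"
      using square_diff_via[of "f (fill Z x y)" "f (fill ?Z x w)" "f (repair Z x y u q)"]
      by (simp add: sh) (simp add: t'(1) jump_def detour_def)
    moreover have "shared t \<in> crowded n d" "shared (slide t) \<in> crowded n d"
      unfolding sh crowded_def repairs_def using t' q uw Z' by auto
    moreover have "slide t \<in> moves n d"
      using t' q uw Z' by (auto simp: slide_def moves_def)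
    ultimately show ?thesis by blast
  qed
  have "inj_on slide (T True True)"
    by (rule inj_on_inverseI[of _ slide]) (auto simp: T_def slide_slide)
  then have "(\<Sum>t\<in>T True True. detour f (shared (slide t))) = (\<Sum>t\<in>slide ` T True True. detour f (shared t))"
    by (simp add: sum.reindex)
  moreover have "(\<Sum>t\<in>slide ` T True True. detour f (shared t)) \<le> real d * V"
    unfolding V_def by (rule sum_shared_le) (use g in auto)
  moreover have "(\<Sum>t\<in>T True True. detour f (shared t)) \<le> real d * V"
    unfolding V_def by (rule sum_shared_le) (use g in \<open>auto simp: T_def\<close>)
  moreover have "(\<Sum>t\<in>T True True. jump f t)
      \<le> (\<Sum>t\<in>T True True. 2 * (detour f (shared t) + detour f (shared (slide t))))"
    by (rule sum_mono) (use g in auto)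
  moreover have "(\<Sum>t\<in>T True True. 2 * (detour f (shared t) + detour f (shared (slide t))))
      = 2 * ((\<Sum>t\<in>T True True. detour f (shared t)) + (\<Sum>t\<in>T True True. detour f (shared (slide t))))"
    by (simp add: sum.distrib sum_distrib_left)
  ultimately have s4: "(\<Sum>t\<in>T True True. jump f t) \<le> 4 * (real d * V)"
    unfolding distrib_left by linarith
  show ?thesis
    using split s0 s1 s2 s3 s4 unfolding V_def[symmetric] S_def[symmetric] by (simp add: algebra_simps)
qed

text \<open>If xy is an edge, delete it. Otherwise invert a repair: x has degree d + 1, more than
  any neighbour p of y, so some neighbour q of x is not adjacent to p, and replacing py and xq by pq
  gives a regular graph. That graph with its edge pq, one of d n, determines L.\<close>

lemma card_surplus_le:
  assumes "x < n" "y < n"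
  shows "card (surplus n d x y) \<le> (d * n + 1) * card (regular_bip n d)"
proof -
  let ?\<Omega> = "regular_bip n d"
  define L0 L1 where "L0 = {L \<in> surplus n d x y. (x, y) \<notin> L}"
    and "L1 = {L \<in> surplus n d x y. (x, y) \<in> L}"
  have "L - {(x, y)} \<in> ?\<Omega>" if "L \<in> L1" for L
  proof -
    have L: "L \<in> surplus n d x y" "(x, y) \<in> L" using that by (auto simp: L1_def)
    have "deg fst (L - {(x, y)}) v = d \<and> deg snd (L - {(x, y)}) v = d" if "v < n" for v
    proof -
      have "deg fst L v = d + of_bool (v = x)" "deg snd L v = d + of_bool (v = y)"
        using L(1) that unfolding surplus_def by blast+
      then show ?thesis
        using deg_remove[OF surplus_finite[OF L(1)] L(2), of fst v]
          deg_remove[OF surplus_finite[OF L(1)] L(2), of snd v] by simp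
    qed
    then show ?thesis using L by (auto simp: surplus_def regular_bip_iff)
  qed
  then have c1: "card L1 \<le> card ?\<Omega>"
    by (intro card_inj_on_le[of "\<lambda>L. L - {(x, y)}"] finite_regular_bip inj_onI) (auto simp: L1_def)
  have ex: "\<exists>p q. (p, y) \<in> L \<and> (x, q) \<in> L \<and> (p, q) \<notin> L" if "L \<in> L0" for L
  proof -
    have L: "L \<in> surplus n d x y" "(x, y) \<notin> L" using that by (auto simp: L0_def)
    have fin: "finite {q. (p, q) \<in> L}" for p
      by (rule finite_subset[of _ "{..<n}"]) (use L(1) in \<open>auto simp: surplus_def\<close>)
    have "deg snd L y \<noteq> 0" using L assms by (auto simp: surplus_def)
    then have "{p. (p, y) \<in> L} \<noteq> {}" unfolding deg_snd by (intro notI) simp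
    then obtain p where p: "(p, y) \<in> L" by blast
    then have "deg fst L p < deg fst L x" using L assms by (auto simp: surplus_def)
    then have "\<not> {q. (x, q) \<in> L} \<subseteq> {q. (p, q) \<in> L}"
      unfolding deg_fst using card_mono[OF fin] by (meson not_le)
    then show ?thesis using p by blast
  qed
  define c where "c = (\<lambda>L. SOME (p, q). (p, y) \<in> L \<and> (x, q) \<in> L \<and> (p, q) \<notin> L)"
  have c: "(fst (c L), y) \<in> L \<and> (x, snd (c L)) \<in> L \<and> c L \<notin> L" if "L \<in> L0" for L
    using someI_ex[of "\<lambda>(p, q). (p, y) \<in> L \<and> (x, q) \<in> L \<and> (p, q) \<notin> L"] ex[OF that]
    by (auto simp: c_def case_prod_unfold)
  define g where "g = (\<lambda>L. (insert (c L) (L - {(fst (c L), y)} - {(x, snd (c L))}), c L))"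
  have "g L \<in> (SIGMA B:?\<Omega>. B)" if "L \<in> L0" for L
  proof -
    have L: "L \<in> surplus n d x y" "(x, y) \<notin> L" using that by (auto simp: L0_def)
    obtain p q where pq: "c L = (p, q)" by force
    have m: "(p, y) \<in> L" "(x, q) \<in> L" "(p, q) \<notin> L" "p \<noteq> x" using c[OF that] L by (auto simp: pq)
    let ?B = "insert (p, q) (L - {(p, y)} - {(x, q)})"
    have "deg k ?B v + of_bool (v = k (p, y)) + of_bool (v = k (x, q)) = deg k L v + of_bool (v = k (p, q))" for k v
      using m surplus_finite[OF L(1)] deg_remove[of L "(p, y)" k v] deg_remove[of "L - {(p, y)}" "(x, q)" k v]
      by (simp add: deg_insert)
    from this[of fst] this[of snd]
    have "deg fst ?B v + of_bool (v = x) = deg fst L v" "deg snd ?B v + of_bool (v = y) = deg snd L v" for v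
      by auto
    moreover have "deg fst L v = d + of_bool (v = x) \<and> deg snd L v = d + of_bool (v = y)" if "v < n" for v
      using L(1) that unfolding surplus_def by blast
    ultimately have "deg fst ?B v = d \<and> deg snd ?B v = d" if "v < n" for v
      using that by (metis add_right_cancel)
    then have "?B \<in> ?\<Omega>" using L m by (auto simp: surplus_def regular_bip_iff)
    then show ?thesis by (simp add: g_def pq)
  qed
  moreover have "inj_on g L0"
  proof (rule inj_onI)
    fix L L' assume *: "L \<in> L0" "L' \<in> L0" "g L = g L'"
    have undo: "L = fst (g L) - {snd (g L)} \<union> {(fst (snd (g L)), y), (x, snd (snd (g L)))}" if "L \<in> L0" for L
      using c[OF that] by (auto simp: g_def)
    show "L = L'" using undo[OF *(1)] undo[OF *(2)] *(3) by simp
  qed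
  moreover have "finite (SIGMA B:?\<Omega>. B)"
    by (intro finite_SigmaI finite_regular_bip) (rule regular_bip_finite)
  ultimately have "card L0 \<le> card (SIGMA B:?\<Omega>. B)"
    by (intro card_inj_on_le[of g] image_subsetI)
  also have "\<dots> = (\<Sum>B\<in>?\<Omega>. card B)"
    using finite_regular_bip regular_bip_finite by (intro card_SigmaI) auto
  also have "\<dots> = card ?\<Omega> * (d * n)" by (simp add: card_regular_bip)
  finally have c0: "card L0 \<le> card ?\<Omega> * (d * n)" .
  have "surplus n d x y = L0 \<union> L1" by (auto simp: L0_def L1_def)
  then have "card (surplus n d x y) \<le> card L0 + card L1" by (simp add: card_Un_le)
  then show ?thesis using c0 c1 by (simp add: algebra_simps)
qed

section \<open>Colour-exchanging pairings\<close>

text \<open>At every vertex of the side selected by k, the edges of one colour are matched with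
  those of the other. Being a permutation of H fixes the values outside H, so that pairings can be
  counted as functions.\<close>

definition pairings :: "('a \<Rightarrow> nat) \<Rightarrow> 'a set \<Rightarrow> 'a set \<Rightarrow> ('a \<Rightarrow> 'a) set" where
  "pairings k c H = {\<alpha>. \<alpha> permutes H \<and>
    (\<forall>e\<in>H. \<alpha> (\<alpha> e) = e \<and> k (\<alpha> e) = k e \<and> (\<alpha> e \<in> c \<longleftrightarrow> e \<notin> c))}"

lemma finite_pairings: "finite H \<Longrightarrow> finite (pairings k c H)"
  by (rule finite_subset[OF _ finite_permutations[of H]]) (auto simp: pairings_def)

text \<open>The two colours play symmetric roles; the case s = False passes from G to G'.\<close>

lemma pairings_cong:
  assumes "\<And>e. e \<in> H \<Longrightarrow> e \<in> c' \<longleftrightarrow> (e \<in> c) = s"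
  shows "pairings k c H \<subseteq> pairings k c' H"
proof
  fix \<alpha> assume "\<alpha> \<in> pairings k c H"
  moreover from this have "\<alpha> e \<in> H" if "e \<in> H" for e
    using that by (auto simp: pairings_def permutes_in_image)
  ultimately show "\<alpha> \<in> pairings k c' H" using assms by (auto simp: pairings_def)
qed

lemma pairing_deg_eq:
  assumes "\<alpha> \<in> pairings k c H" "Q \<subseteq> H" "\<alpha> ` Q \<subseteq> Q"
  shows "deg k (Q \<inter> c) v = deg k (Q - c) v"
proof -
  have "bij_betw \<alpha> {e \<in> Q \<inter> c. k e = v} {e \<in> Q - c. k e = v}"
    using assms by (intro bij_betw_byWitness[where f' = \<alpha>]) (auto simp: pairings_def)
  then show ?thesis unfolding deg_def by (rule bij_betw_same_card)
qed

lemma deg_Un_disjoint: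
  "finite A \<Longrightarrow> finite B \<Longrightarrow> A \<inter> B = {} \<Longrightarrow> deg k (A \<union> B) v = deg k A v + deg k B v"
proof -
  assume "finite A" "finite B" "A \<inter> B = {}"
  moreover have "{e \<in> A \<union> B. k e = v} = {e \<in> A. k e = v} \<union> {e \<in> B. k e = v}" by auto
  ultimately show ?thesis unfolding deg_def by (simp add: card_Un_disjoint disjoint_iff)
qed

text \<open>The pairing matches the edges of Q lost at a vertex with the edges of Q gained
  there.\<close>

lemma deg_sym_diff:
  assumes "\<alpha> \<in> pairings k G H" "Q \<subseteq> H" "\<alpha> ` Q \<subseteq> Q" "finite G" "finite H"
  shows "deg k (sym_diff G Q) v = deg k G v"
proof -
  have fQ: "finite Q" using assms by (auto intro: finite_subset)
  have "deg k (sym_diff G Q) v = deg k (G - Q) v + deg k (Q - G) v"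
    using assms fQ by (intro deg_Un_disjoint) auto
  also have "\<dots> = deg k (G - Q) v + deg k (Q \<inter> G) v"
    using pairing_deg_eq[OF assms(1-3)] by simp
  also have "\<dots> = deg k ((G - Q) \<union> (Q \<inter> G)) v"
    using assms fQ by (intro deg_Un_disjoint[symmetric]) auto
  also have "(G - Q) \<union> (Q \<inter> G) = G" by auto
  finally show ?thesis .
qed

text \<open>The two labellings of H by (vertex, colour) have the same multiset of labels, so a
  permutation of H carries one to the other.\<close>

lemma recolouring:
  assumes "finite H" and "\<And>v. deg k (H \<inter> c) v = deg k (H \<inter> c') v" "\<And>v. deg k (H - c) v = deg k (H - c') v"
  obtains \<tau> where "\<tau> permutes H" "\<And>e. e \<in> H \<Longrightarrow> k (\<tau> e) = k e" "\<And>e. e \<in> H \<Longrightarrow> \<tau> e \<in> c' \<longleftrightarrow> e \<in> c"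
proof -
  let ?f = "\<lambda>c e. (k e, e \<in> c)"
  have "card {e \<in> H. ?f c e = j} = card {e \<in> H. ?f c' e = j}" for j
  proof (cases j)
    case (Pair v b)
    have "{e \<in> H. ?f a e = j} = {e \<in> (if b then H \<inter> a else H - a). k e = v}" for a
      by (auto simp: Pair)
    then show ?thesis using assms(2)[of v] assms(3)[of v] by (auto simp: deg_def)
  qed
  then have "image_mset (?f c) (mset_set H) = image_mset (?f c') (mset_set H)"
    using assms(1) by (intro multiset_eqI) (simp add: count_image_mset Int_def vimage_def conj_commute)
  from image_mset_eq_implies_permutes[OF assms(1) this]
  obtain p where "p permutes H" "\<forall>x\<in>H. ?f c x = ?f c' (p x)" .
  then show ?thesis by (intro that[of p]) auto
qed

lemma pairings_nonempty:
  assumes "finite H" "\<And>v. deg k (H \<inter> c) v = deg k (H - c) v"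
  shows "pairings k c H \<noteq> {}"
proof -
  have "H \<inter> (- c) = H - c" "H - (- c) = H \<inter> c" by auto
  then obtain \<tau> where \<tau>: "\<tau> permutes H" "\<And>e. e \<in> H \<Longrightarrow> k (\<tau> e) = k e"
      "\<And>e. e \<in> H \<Longrightarrow> \<tau> e \<in> - c \<longleftrightarrow> e \<in> c"
    using assms by (metis recolouring)
  define \<tau>' where "\<tau>' = inv \<tau>"
  have \<tau>': "\<tau> (\<tau>' e) = e" "\<tau>' (\<tau> e) = e" "\<tau>' e \<in> H \<longleftrightarrow> e \<in> H" "\<tau> e \<in> H \<longleftrightarrow> e \<in> H" for e
    using permutes_inverses[OF \<tau>(1)] permutes_in_image[OF permutes_inv[OF \<tau>(1)]] permutes_in_image[OF \<tau>(1)]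
    by (simp_all add: \<tau>'_def)
  have k': "k (\<tau>' e) = k e" "\<tau>' e \<in> c \<longleftrightarrow> e \<notin> c" if "e \<in> H" for e
    using \<tau>(2,3)[of "\<tau>' e"] \<tau>' that by auto
  \<comment> \<open>Using \<tau> on one colour class and its inverse on the other turns the
    recolouring of c into its complement into an involution.\<close>
  define \<alpha> where "\<alpha> = (\<lambda>e. if e \<in> H then if e \<in> c then \<tau> e else \<tau>' e else e)"
  have inv: "\<alpha> (\<alpha> e) = e" for e
    using \<tau>' \<tau>(3)[of e] k'(2)[of e] by (auto simp: \<alpha>_def)
  have "\<alpha> e = e" if "e \<notin> H" for e using that by (simp add: \<alpha>_def)
  then have "\<alpha> permutes H" unfolding permutes_def by (metis inv)
  then have "\<alpha> \<in> pairings k c H"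
    using inv \<tau>(2,3) k' by (auto simp: pairings_def) (auto simp: \<alpha>_def)
  then show ?thesis by auto
qed

text \<open>A colouring that admits a pairing has exactly half of the edges at every vertex in each
  colour. Any two such colourings are thus related by a recolouring, and conjugation with it carries
  pairings of one to pairings of the other.\<close>

lemma card_pairings_le:
  assumes fin: "finite H" and ne: "pairings k c H \<noteq> {}" "pairings k c' H \<noteq> {}"
  shows "card (pairings k c H) \<le> card (pairings k c' H)"
proof -
  have half: "2 * deg k (H \<inter> a) v = deg k H v" "deg k (H - a) v = deg k (H \<inter> a) v"
    if ne: "pairings k a H \<noteq> {}" for a v
  proof -
    obtain \<alpha> where \<alpha>: "\<alpha> \<in> pairings k a H" using ne by auto
    then have "\<alpha> ` H \<subseteq> H" by (auto simp: pairings_def permutes_in_image)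
    from pairing_deg_eq[OF \<alpha> _ this] show "deg k (H - a) v = deg k (H \<inter> a) v" by simp
    moreover have "deg k ((H \<inter> a) \<union> (H - a)) v = deg k (H \<inter> a) v + deg k (H - a) v"
      using fin by (intro deg_Un_disjoint) auto
    moreover have "(H \<inter> a) \<union> (H - a) = H" by auto
    ultimately show "2 * deg k (H \<inter> a) v = deg k H v" by simp
  qed
  have eq: "deg k (H \<inter> c) v = deg k (H \<inter> c') v" for v
    using half(1)[OF ne(1), of v] half(1)[OF ne(2), of v] by simp
  then obtain \<tau> where \<tau>: "\<tau> permutes H" "\<And>e. e \<in> H \<Longrightarrow> k (\<tau> e) = k e"
      "\<And>e. e \<in> H \<Longrightarrow> \<tau> e \<in> c' \<longleftrightarrow> e \<in> c"
    using recolouring[OF fin eq] half(2)[OF ne(1)] half(2)[OF ne(2)] by metis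
  define \<tau>' where "\<tau>' = inv \<tau>"
  have \<tau>': "\<tau> (\<tau>' e) = e" "\<tau>' (\<tau> e) = e" "\<tau>' e \<in> H \<longleftrightarrow> e \<in> H" "\<tau> e \<in> H \<longleftrightarrow> e \<in> H" for e
    using permutes_inverses[OF \<tau>(1)] permutes_in_image[OF permutes_inv[OF \<tau>(1)]] permutes_in_image[OF \<tau>(1)]
    by (simp_all add: \<tau>'_def)
  have k': "k (\<tau>' e) = k e" "\<tau>' e \<in> c \<longleftrightarrow> e \<in> c'" if "e \<in> H" for e
    using \<tau>(2,3)[of "\<tau>' e"] \<tau>' that by auto
  let ?F = "\<lambda>\<alpha>. \<tau> \<circ> \<alpha> \<circ> \<tau>'"
  show ?thesis
  proof (rule card_inj_on_le[of ?F])
    show "inj_on ?F (pairings k c H)"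
    proof (rule inj_onI)
      fix \<alpha> \<beta> assume eq: "?F \<alpha> = ?F \<beta>"
      show "\<alpha> = \<beta>"
      proof
        fix e
        have "\<tau>' (?F \<alpha> (\<tau> e)) = \<tau>' (?F \<beta> (\<tau> e))" by (simp only: eq)
        then show "\<alpha> e = \<beta> e" by (simp only: comp_apply \<tau>'(2))
      qed
    qed
    show "?F ` pairings k c H \<subseteq> pairings k c' H"
    proof
      fix \<gamma> assume "\<gamma> \<in> ?F ` pairings k c H"
      then obtain \<alpha> where \<gamma>: "\<gamma> = ?F \<alpha>" and \<alpha>: "\<alpha> \<in> pairings k c H" by blast
      have "\<gamma> permutes H" unfolding \<gamma> \<tau>'_def
        using \<alpha> \<tau>(1) by (intro permutes_compose permutes_inv) (auto simp: pairings_def)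
      moreover have "\<gamma> (\<gamma> e) = e \<and> k (\<gamma> e) = k e \<and> (\<gamma> e \<in> c' \<longleftrightarrow> e \<notin> c')" if "e \<in> H" for e
      proof -
        have "\<tau>' e \<in> H" using that \<tau>' by simp
        then have "\<alpha> (\<alpha> (\<tau>' e)) = \<tau>' e" "k (\<alpha> (\<tau>' e)) = k (\<tau>' e)" "\<alpha> (\<tau>' e) \<in> c \<longleftrightarrow> \<tau>' e \<notin> c" "\<alpha> (\<tau>' e) \<in> H"
          using \<alpha> by (auto simp: pairings_def permutes_in_image)
        then show ?thesis using \<tau>(2,3)[of "\<alpha> (\<tau>' e)"] k'[OF that] by (simp add: \<gamma> \<tau>')
      qed
      ultimately show "\<gamma> \<in> pairings k c' H" by (simp add: pairings_def)
    qed
  qed (rule finite_pairings[OF fin])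
qed

lemma card_pairings_eq:
  "finite H \<Longrightarrow> pairings k c H \<noteq> {} \<Longrightarrow> pairings k c' H \<noteq> {} \<Longrightarrow>
    card (pairings k c H) = card (pairings k c' H)"
  by (intro le_antisym card_pairings_le)

section \<open>Alternating closed trails\<close>

text \<open>For two pairings of an alternating colouring this is the edge set of one closed
  trail.\<close>

definition component :: "('a \<Rightarrow> 'a) \<Rightarrow> ('a \<Rightarrow> 'a) \<Rightarrow> 'a \<Rightarrow> 'a set" where
  "component \<alpha> \<beta> e = {e'. (e, e') \<in> (range (\<lambda>x. (x, \<alpha> x)) \<union> range (\<lambda>x. (x, \<beta> x)))\<^sup>*}"

definition rank :: "bgraph \<Rightarrow> nat" where
  "rank A = set_encode (prod_encode ` A)"

lemma inj_on_rank: "inj_on rank (Collect finite)"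
proof (rule inj_onI)
  fix A B :: bgraph assume "A \<in> Collect finite" "B \<in> Collect finite" "rank A = rank B"
  then have "prod_encode ` A = prod_encode ` B"
    by (simp add: rank_def set_encode_eq)
  then show "A = B" by (simp add: inj_image_eq_iff inj_prod_encode)
qed

text \<open>The powers of \<alpha> \<circ> \<beta> run through the G-edges of the trail, and \<beta>
  gives the G'-edges between them. The index ranges differ by one, so the piece begins and ends with
  a G-edge.\<close>

definition trail :: "('a \<Rightarrow> 'a) \<Rightarrow> ('a \<Rightarrow> 'a) \<Rightarrow> 'a \<Rightarrow> nat \<Rightarrow> 'a set" where
  "trail \<alpha> \<beta> a i = (\<lambda>j. ((\<alpha> \<circ> \<beta>) ^^ j) a) ` {..i} \<union> (\<lambda>j. \<beta> (((\<alpha> \<circ> \<beta>) ^^ j) a)) ` {..<i}"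

definition index :: "('a \<Rightarrow> 'a) \<Rightarrow> ('a \<Rightarrow> 'a) \<Rightarrow> 'a \<Rightarrow> 'a \<Rightarrow> nat" where
  "index \<alpha> \<beta> a e = (LEAST i. ((\<alpha> \<circ> \<beta>) ^^ i) a = e)"

definition earlier :: "bgraph \<Rightarrow> (nat \<times> nat \<Rightarrow> nat \<times> nat) \<Rightarrow> (nat \<times> nat \<Rightarrow> nat \<times> nat) \<Rightarrow> nat \<Rightarrow> bgraph" where
  "earlier H \<alpha> \<beta> r = {e \<in> H. rank (component \<alpha> \<beta> e) < r}"

text \<open>Components are processed in the order of an injective code that does not depend on the two
  graphs, so that the processed set can be recovered from the pairings and the two ends alone.\<close>

definition processed :: "bgraph \<Rightarrow> (nat \<times> nat \<Rightarrow> nat \<times> nat) \<Rightarrow> (nat \<times> nat \<Rightarrow> nat \<times> nat) \<Rightarrow>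
    nat \<times> nat \<Rightarrow> nat \<times> nat \<Rightarrow> bgraph" where
  "processed H \<alpha> \<beta> a e = earlier H \<alpha> \<beta> (rank (component \<alpha> \<beta> a)) \<union> trail \<alpha> \<beta> a (index \<alpha> \<beta> a e)"

section \<open>The orbits of two pairings\<close>

locale alternating =
  fixes G H :: bgraph and \<alpha> \<beta> :: "nat \<times> nat \<Rightarrow> nat \<times> nat"
  assumes finite_H: "finite H"
    and \<alpha>: "\<alpha> \<in> pairings fst G H" and \<beta>: "\<beta> \<in> pairings snd G H"
begin

abbreviation "cmp \<equiv> component \<alpha> \<beta>"
abbreviation "\<sigma> \<equiv> \<alpha> \<circ> \<beta>"

lemma in_H [simp]: "\<alpha> e \<in> H \<longleftrightarrow> e \<in> H" "\<beta> e \<in> H \<longleftrightarrow> e \<in> H"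
  using \<alpha> \<beta> by (simp_all add: pairings_def permutes_in_image)

lemma invol [simp]: "\<alpha> (\<alpha> e) = e" "\<beta> (\<beta> e) = e"
proof -
  show "\<alpha> (\<alpha> e) = e" using \<alpha> permutes_not_in[of \<alpha> H e] by (cases "e \<in> H") (auto simp: pairings_def)
  show "\<beta> (\<beta> e) = e" using \<beta> permutes_not_in[of \<beta> H e] by (cases "e \<in> H") (auto simp: pairings_def)
qed

lemma colour: "e \<in> H \<Longrightarrow> \<alpha> e \<in> G \<longleftrightarrow> e \<notin> G" "e \<in> H \<Longrightarrow> \<beta> e \<in> G \<longleftrightarrow> e \<notin> G"
  using \<alpha> \<beta> by (simp_all add: pairings_def)

lemma keys: "e \<in> H \<Longrightarrow> fst (\<alpha> e) = fst e" "e \<in> H \<Longrightarrow> snd (\<beta> e) = snd e"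
  using \<alpha> \<beta> by (simp_all add: pairings_def)

lemma inj_pair: "\<alpha> e = \<alpha> e' \<longleftrightarrow> e = e'" "\<beta> e = \<beta> e' \<longleftrightarrow> e = e'"
proof -
  have "e = e'" if "\<alpha> e = \<alpha> e'" using arg_cong[OF that, of \<alpha>] by simp
  moreover have "e = e'" if "\<beta> e = \<beta> e'" using arg_cong[OF that, of \<beta>] by simp
  ultimately show "\<alpha> e = \<alpha> e' \<longleftrightarrow> e = e'" "\<beta> e = \<beta> e' \<longleftrightarrow> e = e'" by blast+
qed

lemma comp_refl: "e \<in> cmp e"
  by (simp add: component_def)

lemma comp_eq:
  assumes "e' \<in> cmp e" shows "cmp e' = cmp e"
proof -
  let ?R = "range (\<lambda>x. (x, \<alpha> x)) \<union> range (\<lambda>x. (x, \<beta> x))"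
  have "sym ?R" by (rule symI) (use invol in \<open>fastforce simp: image_iff\<close>)
  then have "sym (?R\<^sup>*)" by (rule sym_rtrancl)
  then have "(e', e) \<in> ?R\<^sup>*" "(e, e') \<in> ?R\<^sup>*" using assms by (auto simp: component_def dest: symD)
  then show ?thesis unfolding component_def by (auto intro: rtrancl_trans)
qed

lemma comp_step [simp]: "cmp (\<alpha> e) = cmp e" "cmp (\<beta> e) = cmp e"
  by (rule comp_eq; unfold component_def mem_Collect_eq; rule r_into_rtrancl; blast)+

lemma comp_subset:
  assumes "e \<in> S" "\<And>x. x \<in> S \<Longrightarrow> \<alpha> x \<in> S" "\<And>x. x \<in> S \<Longrightarrow> \<beta> x \<in> S"
  shows "cmp e \<subseteq> S"
proof
  fix e' assume "e' \<in> cmp e"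
  then have "(e, e') \<in> (range (\<lambda>x. (x, \<alpha> x)) \<union> range (\<lambda>x. (x, \<beta> x)))\<^sup>*" by (simp add: component_def)
  then show "e' \<in> S" by induction (use assms in auto)
qed

lemma comp_H: "e \<in> H \<Longrightarrow> cmp e \<subseteq> H"
  by (rule comp_subset) auto

lemma pow_G: "a \<in> H \<inter> G \<Longrightarrow> (\<sigma> ^^ j) a \<in> H \<inter> G"
  by (induction j) (auto simp: colour)

lemma pow_comp [simp]: "cmp ((\<sigma> ^^ j) a) = cmp a"
  by (induction j) auto

lemma pow_cancel: "(\<sigma> ^^ Suc i) a = (\<sigma> ^^ Suc j) b \<longleftrightarrow> (\<sigma> ^^ i) a = (\<sigma> ^^ j) b"
  by (simp add: inj_pair)

lemma pow_cancel_add: "(\<sigma> ^^ (k + i)) a = (\<sigma> ^^ (k + j)) b \<longleftrightarrow> (\<sigma> ^^ i) a = (\<sigma> ^^ j) b"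
  by (induction k) (simp_all only: add_Suc add_0 pow_cancel)

lemma periodic:
  assumes "a \<in> H" obtains k where "k > 0" "(\<sigma> ^^ k) a = a"
proof -
  have "inj \<sigma>" by (rule injI) (simp add: inj_pair)
  moreover have "(\<sigma> ^^ n) a \<in> H" for n by (induction n) (use assms in auto)
  then have "finite {y. \<exists>n. y = (\<sigma> ^^ n) a}"
    by (intro finite_subset[OF _ finite_H]) auto
  ultimately show ?thesis using that by (rule funpow_inj_finite)
qed

lemma comp_orbit:
  assumes a: "a \<in> H"
  shows "cmp a \<subseteq> range (\<lambda>j. (\<sigma> ^^ j) a) \<union> range (\<lambda>j. \<beta> ((\<sigma> ^^ j) a))" (is "_ \<subseteq> ?S")
proof (rule comp_subset)
  show "a \<in> ?S" by (auto intro: range_eqI[of _ _ 0])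
next
  fix x assume "x \<in> ?S"
  then consider j where "x = (\<sigma> ^^ j) a" | j where "x = \<beta> ((\<sigma> ^^ j) a)" by blast
  then show "\<alpha> x \<in> ?S"
  proof cases
    case 1
    \<comment> \<open>For j = 0 the edge has no predecessor in the list; adding a full period
      supplies one.\<close>
    obtain k where k: "k > 0" "(\<sigma> ^^ k) a = a" using periodic[OF a] .
    have "x = (\<sigma> ^^ (j + k)) a" using k(2) by (simp add: 1 funpow_add)
    moreover obtain m where "j + k = Suc m" using k(1) by (metis add_gr_0 gr0_implies_Suc)
    ultimately have "\<alpha> x = \<beta> ((\<sigma> ^^ m) a)" by simp
    then show ?thesis by blast
  next
    case 2
    then have "\<alpha> x = (\<sigma> ^^ Suc j) a" by simp
    then show ?thesis by blast
  qed
  show "\<beta> x \<in> ?S" using \<open>x \<in> ?S\<close> by auto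
qed

lemma comp_blue:
  assumes "a \<in> H \<inter> G" "e \<in> cmp a" "e \<in> G"
  shows "\<exists>j. e = (\<sigma> ^^ j) a"
proof -
  have "e \<noteq> \<beta> ((\<sigma> ^^ j) a)" for j
  proof
    assume "e = \<beta> ((\<sigma> ^^ j) a)"
    then show False using pow_G[OF assms(1), of j] colour(2)[of "(\<sigma> ^^ j) a"] assms(3) by auto
  qed
  then show ?thesis using comp_orbit[of a] assms(1,2) by blast
qed

end

section \<open>A partly traversed trail\<close>

locale trail_point = alternating +
  fixes a e :: "nat \<times> nat"
  assumes a: "a \<in> H \<inter> G" and e: "e \<in> G" "e \<in> cmp a"
begin

abbreviation "s j \<equiv> (\<sigma> ^^ j) a"

definition "i = index \<alpha> \<beta> a e"

definition "P = processed H \<alpha> \<beta> a e"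

lemma s_i: "s i = e" and s_less: "j < i \<Longrightarrow> s j \<noteq> e"
proof -
  show "s i = e" unfolding i_def index_def
    using comp_blue[OF a e(2,1)] by (metis (mono_tags, lifting) LeastI)
  show "j < i \<Longrightarrow> s j \<noteq> e" unfolding i_def index_def using not_less_Least by blast
qed

text \<open>A repetition could be shifted until its later member is e, which would then occur before
  its first visit.\<close>

lemma s_inj: "j < l \<Longrightarrow> l \<le> i \<Longrightarrow> s j \<noteq> s l"
proof
  assume *: "j < l" "l \<le> i" "s j = s l"
  have "s ((i - l) + j) = s ((i - l) + l)" using *(3) by (simp only: pow_cancel_add)
  then have "s (i - l + j) = e" using *(2) s_i by simp
  then show False using s_less[of "i - l + j"] * by linarith
qed

lemma s_HG: "s j \<in> H" "s j \<in> G"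
  using pow_G[OF a, of j] by auto

lemma red: "\<beta> (s j) \<in> H" "\<beta> (s j) \<notin> G"
  using s_HG[of j] by (simp_all add: colour)

lemma P_iff: "x \<in> P \<longleftrightarrow> (x \<in> H \<and> rank (cmp x) < rank (cmp a)) \<or> (\<exists>j\<le>i. x = s j) \<or> (\<exists>j<i. x = \<beta> (s j))"
  by (auto simp: P_def processed_def earlier_def trail_def i_def)

lemma P_comp_iff:
  assumes "cmp x = cmp a" shows "x \<in> P \<longleftrightarrow> (\<exists>j\<le>i. x = s j) \<or> (\<exists>j<i. x = \<beta> (s j))"
  using assms by (simp add: P_iff)

lemma P_subset: "P \<subseteq> H"
  using s_HG red by (auto simp: P_iff)

lemma a_P: "a \<in> P" and e_P: "e \<in> P"
proof -
  have "a = s 0" "e = s i" by (simp_all add: s_i)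
  then show "a \<in> P" "e \<in> P" unfolding P_iff by blast+
qed

text \<open>Every later G-edge of the trail was reached through its \<alpha>-partner, and completed
  trails are closed; on the X side only the pair of the first edge may be broken.\<close>

lemma alpha_closed: "\<alpha> ` (P - {a}) \<subseteq> P - {a}"
proof (rule image_subsetI)
  fix x assume x: "x \<in> P - {a}"
  then consider "x \<in> H" "rank (cmp x) < rank (cmp a)" | j where "j \<le> i" "x = s j" | j where "j < i" "x = \<beta> (s j)"
    by (auto simp: P_iff)
  then show "\<alpha> x \<in> P - {a}"
  proof cases
    case 1
    then have "\<alpha> x \<noteq> a" by (metis comp_step(1) less_irrefl)
    then show ?thesis using 1 by (simp add: P_iff)
  next
    case (2 j)
    then obtain l where l: "j = Suc l" using x by (cases j) auto
    then have "\<alpha> x = \<beta> (s l)" by (simp add: 2)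
    moreover have "l < i" using 2 l by simp
    moreover have "\<beta> (s l) \<noteq> a" using red(2)[of l] a by auto
    ultimately show ?thesis unfolding Diff_iff P_iff singleton_iff by metis
  next
    case (3 j)
    then have "\<alpha> x = s (Suc j)" by simp
    then show ?thesis using s_inj[of 0 "Suc j"] 3 unfolding P_iff by (metis DiffI P_iff Suc_leI funpow_0 singletonD zero_less_Suc)
  qed
qed

text \<open>On the Y side only the pair of the current edge is broken, since its \<beta>-partner
  comes next.\<close>

lemma beta_closed: "\<beta> ` (P - {e}) \<subseteq> P - {e}"
proof (rule image_subsetI)
  fix x assume x: "x \<in> P - {e}"
  then consider "x \<in> H" "rank (cmp x) < rank (cmp a)" | j where "j \<le> i" "x = s j" | j where "j < i" "x = \<beta> (s j)"
    by (auto simp: P_iff)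
  then show "\<beta> x \<in> P - {e}"
  proof cases
    case 1
    then have "\<beta> x \<noteq> e" using comp_eq[OF e(2)] by (metis comp_step(2) less_irrefl)
    then show ?thesis using 1 by (simp add: P_iff)
  next
    case (2 j)
    then have "j < i" using x s_i by (metis DiffE insertI1 le_neq_implies_less)
    moreover have "\<beta> (s j) \<noteq> e" using red(2)[of j] e by auto
    ultimately show ?thesis unfolding Diff_iff P_iff singleton_iff using 2 by metis
  next
    case (3 j)
    then have "\<beta> x = s j" "s j \<noteq> e" "j \<le> i" using s_less[of j] by simp_all
    then show ?thesis unfolding Diff_iff P_iff singleton_iff by metis
  qed
qed

lemma beta_e: "\<beta> e \<notin> P" "\<beta> e \<notin> G"
proof -
  show "\<beta> e \<notin> G" using red(2)[of i] s_i by simp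
  then show "\<beta> e \<notin> P"
    using s_HG s_less comp_eq[OF e(2)] by (auto simp: P_comp_iff inj_pair)
qed

lemma sigma_e: assumes "\<sigma> e \<noteq> a" shows "\<sigma> e \<notin> P" "\<sigma> e \<in> G"
proof -
  have se: "\<sigma> e = s (Suc i)" using s_i by simp
  then show G: "\<sigma> e \<in> G" using s_HG(2)[of "Suc i"] by simp
  have "\<sigma> e \<noteq> s j" if "j \<le> i" for j
  proof (cases j)
    case (Suc l)
    then have "s l \<noteq> s i" using that s_inj[of l i] by simp
    then show ?thesis unfolding se Suc pow_cancel by simp
  qed (use assms in simp)
  moreover have "\<sigma> e \<noteq> \<beta> (s j)" for j using G red(2)[of j] by auto
  moreover have "cmp (\<sigma> e) = cmp a" using comp_eq[OF e(2)] by simp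
  ultimately show "\<sigma> e \<notin> P" by (simp only: P_comp_iff) blast
qed

lemma processed_next:
  assumes "\<sigma> e \<noteq> a"
  shows "processed H \<alpha> \<beta> a (\<sigma> e) = insert (\<beta> e) (insert (\<sigma> e) P)"
proof -
  have se: "\<sigma> e = s (Suc i)" using s_i by simp
  have "index \<alpha> \<beta> a (\<sigma> e) = Suc i"
    unfolding index_def
  proof (rule Least_equality)
    show "s (Suc i) = \<sigma> e" using se by simp
    fix j assume "s j = \<sigma> e"
    then show "Suc i \<le> j"
    proof (cases j)
      case (Suc l)
      with \<open>s j = \<sigma> e\<close> have "s l = e" unfolding se Suc pow_cancel by (simp add: s_i)
      then show ?thesis using s_less[of l] Suc by (meson not_less_eq_eq not_less)
    qed (use assms in simp)
  qed
  moreover have "trail \<alpha> \<beta> a (Suc i) = insert (\<beta> e) (insert (\<sigma> e) (trail \<alpha> \<beta> a i))"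
    unfolding trail_def atMost_Suc lessThan_Suc using se s_i by auto
  ultimately show ?thesis
    by (simp add: P_def processed_def i_def)
qed

end

section \<open>The canonical path between two regular graphs\<close>

lemma sum_lessThan_diff:
  "(\<Sum>j<k. h j - h (Suc j)) = h 0 - (h k :: real)"
  by (induction k) auto

locale regular_pair =
  fixes n d :: nat and G G' :: bgraph and \<alpha> \<beta> :: "nat \<times> nat \<Rightarrow> nat \<times> nat"
  assumes G: "G \<in> regular_bip n d" and G': "G' \<in> regular_bip n d"
    and \<alpha>: "\<alpha> \<in> pairings fst G (sym_diff G G')" and \<beta>: "\<beta> \<in> pairings snd G (sym_diff G G')"
begin

definition "H = sym_diff G G'"

sublocale alternating G H \<alpha> \<beta>
  using G G' \<alpha> \<beta> by unfold_locales (auto simp: H_def regular_bip_finite)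

lemma H_grid: "H \<subseteq> {..<n} \<times> {..<n}"
  using G G' by (auto simp: H_def regular_bip_def)

lemma pairings_G': "\<alpha> \<in> pairings fst G' H" "\<beta> \<in> pairings snd G' H"
  using \<alpha> \<beta> pairings_cong[of H G' G False fst] pairings_cong[of H G' G False snd] by (auto simp: H_def)

text \<open>The choice depends on G and cannot be repeated before G is known; a code therefore has
  to record the start edge.\<close>

definition start :: "bgraph \<Rightarrow> nat \<times> nat" where
  "start C = (SOME a. a \<in> C \<inter> G)"

lemma start:
  assumes "e \<in> H \<inter> G"
  shows "start (cmp e) \<in> H \<inter> G" "e \<in> cmp (start (cmp e))" "cmp (start (cmp e)) = cmp e"
proof -
  have "start (cmp e) \<in> cmp e \<inter> G"
    unfolding start_def by (rule someI[of _ e]) (use assms comp_refl in auto)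
  then show "start (cmp e) \<in> H \<inter> G" "cmp (start (cmp e)) = cmp e"
    using comp_H[of e] comp_eq[of "start (cmp e)" e] assms by auto
  then show "e \<in> cmp (start (cmp e))" using comp_refl by simp
qed

definition state :: "nat \<times> nat \<Rightarrow> bgraph" where
  "state e = sym_diff G (processed H \<alpha> \<beta> (start (cmp e)) e)"

definition costate :: "nat \<times> nat \<Rightarrow> bgraph" where
  "costate e = sym_diff G' (processed H \<alpha> \<beta> (start (cmp e)) e)"

definition site_of :: "nat \<times> nat \<Rightarrow> site" where
  "site_of e = ((fst (start (cmp e)), snd e), state e, \<sigma> e)"

definition level :: "(bgraph \<Rightarrow> real) \<Rightarrow> nat \<times> nat \<Rightarrow> real" where
  "level f e = f (fill (state e) (fst (start (cmp e))) (snd e))"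

lemma trail_point: "e \<in> H \<inter> G \<Longrightarrow> trail_point G H \<alpha> \<beta> (start (cmp e)) e"
  using start[of e] by unfold_locales auto

text \<open>The two sides are treated separately: flipping P - {a}, closed under \<alpha>, keeps the
  degrees in X, and flipping P - {e}, closed under \<beta>, those in Y. Either result differs from
  the actual state by one edge, also when a = e.\<close>

lemma state_properties:
  assumes eH: "e \<in> H \<inter> G"
  defines "a \<equiv> start (cmp e)"
  shows "state e \<in> deficit n d (fst a) (snd e)" "costate e \<in> surplus n d (fst a) (snd e)"
    "a \<in> costate e - state e" "e \<in> costate e - state e"
    "\<alpha> \<in> pairings fst (insert a (state e)) H" "\<beta> \<in> pairings snd (insert e (state e)) H"
    "sym_diff (state e) (costate e) = H"
proof -
  interpret trail_point G H \<alpha> \<beta> a e unfolding a_def by (rule trail_point[OF eH])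
  have st: "state e = sym_diff G P" "costate e = sym_diff G' P"
    by (simp_all add: state_def costate_def P_def flip: a_def)
  have aH: "a \<in> H" "a \<in> G" "a \<notin> G'" "e \<in> H" "e \<in> G" "e \<notin> G'" "a \<in> P" "e \<in> P"
    using a eH a_P e_P by (auto simp: H_def)
  have fin: "finite G" "finite G'" "finite P"
    using G G' P_subset finite_H by (auto intro: regular_bip_finite finite_subset)
  have degs: "deg fst (sym_diff G (P - {a})) v = deg fst G v" "deg snd (sym_diff G (P - {e})) v = deg snd G v"
      "deg fst (sym_diff G' (P - {a})) v = deg fst G' v" "deg snd (sym_diff G' (P - {e})) v = deg snd G' v" for v
    using P_subset alpha_closed beta_closed fin finite_H
      pairings_G' alternating.\<alpha>[OF alternating_axioms] alternating.\<beta>[OF alternating_axioms]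
    by (intro deg_sym_diff[where H = H]; blast)+
  have ins: "sym_diff G (P - {a}) = insert a (state e)" "sym_diff G (P - {e}) = insert e (state e)"
      "insert a (sym_diff G' (P - {a})) = costate e" "insert e (sym_diff G' (P - {e})) = costate e"
    using aH by (auto simp: st)
  show mem: "a \<in> costate e - state e" "e \<in> costate e - state e" using aH by (auto simp: st)
  have notin: "a \<notin> sym_diff G' (P - {a})" "e \<notin> sym_diff G' (P - {e})" using aH by auto
  have reg: "deg fst G v = d \<and> deg snd G v = d \<and> deg fst G' v = d \<and> deg snd G' v = d" if "v < n" for v
    using G G' that by (simp add: regular_bip_iff)
  have grid: "state e \<subseteq> {..<n} \<times> {..<n}" "costate e \<subseteq> {..<n} \<times> {..<n}"
    using G G' P_subset H_grid unfolding st by (auto simp: regular_bip_iff)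
  have fin': "finite (state e)" "finite (sym_diff G' (P - {a}))" "finite (sym_diff G' (P - {e}))"
    using fin by (auto simp: st)
  have dZ: "deg fst (state e) v + of_bool (v = fst a) = deg fst G v"
      "deg snd (state e) v + of_bool (v = snd e) = deg snd G v" for v
    using degs(1,2)[of v] mem deg_insert[OF fin'(1), of a fst v] deg_insert[OF fin'(1), of e snd v]
    unfolding ins by simp_all
  have dL: "deg fst (costate e) v = deg fst G' v + of_bool (v = fst a)"
      "deg snd (costate e) v = deg snd G' v + of_bool (v = snd e)" for v
    using degs(3,4)[of v] deg_insert[OF fin'(2) notin(1), of fst v] deg_insert[OF fin'(3) notin(2), of snd v]
    unfolding ins by simp_all
  show "state e \<in> deficit n d (fst a) (snd e)"
    unfolding deficit_def using grid(1) dZ reg by simp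
  show "costate e \<in> surplus n d (fst a) (snd e)"
    unfolding surplus_def using grid(2) dL reg by simp
  show "sym_diff (state e) (costate e) = H"
    using P_subset unfolding st by (auto simp: H_def)
  \<comment> \<open>With its end edge restored, the state agrees with G off a set invariant under
    the pairing and is opposite to G on it, so the colours are still exchanged.\<close>
  have flip: "x \<in> insert a (state e) \<longleftrightarrow> (x \<in> G) = (x \<notin> P - {a})"
      "x \<in> insert e (state e) \<longleftrightarrow> (x \<in> G) = (x \<notin> P - {e})" for x
    unfolding ins(1,2)[symmetric] by auto
  have inva: "\<alpha> x \<in> P - {a} \<longleftrightarrow> x \<in> P - {a}" for x
  proof
    assume "\<alpha> x \<in> P - {a}"
    then have "\<alpha> (\<alpha> x) \<in> P - {a}" using alpha_closed by blast
    then show "x \<in> P - {a}" by simp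
  qed (use alpha_closed in blast)
  have invb: "\<beta> x \<in> P - {e} \<longleftrightarrow> x \<in> P - {e}" for x
  proof
    assume "\<beta> x \<in> P - {e}"
    then have "\<beta> (\<beta> x) \<in> P - {e}" using beta_closed by blast
    then show "x \<in> P - {e}" by simp
  qed (use beta_closed in blast)
  show "\<alpha> \<in> pairings fst (insert a (state e)) H"
    using alternating.\<alpha>[OF alternating_axioms] unfolding pairings_def mem_Collect_eq flip inva by auto
  show "\<beta> \<in> pairings snd (insert e (state e)) H"
    using alternating.\<beta>[OF alternating_axioms] unfolding pairings_def mem_Collect_eq flip invb by auto
qed

lemma site_move:
  assumes eH: "e \<in> H \<inter> G" and ne: "\<sigma> e \<noteq> start (cmp e)"
  shows "site_of e \<in> moves n d" "jump f (site_of e) = (level f e - level f (\<sigma> e))\<^sup>2"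
proof -
  define a where "a = start (cmp e)"
  interpret trail_point G H \<alpha> \<beta> a e unfolding a_def by (rule trail_point[OF eH])
  have ne': "\<sigma> e \<noteq> a" using ne by (simp add: a_def)
  have st: "state e = sym_diff G P" by (simp add: state_def P_def flip: a_def)
  have Z: "state e \<in> deficit n d (fst a) (snd e)"
    using state_properties(1)[OF eH] by (simp add: a_def)
  have lt: "fst a < n" "snd e < n" using H_grid a eH by auto
  have in1: "\<sigma> e \<in> state e" and in2: "\<beta> e \<notin> state e"
    using sigma_e[OF ne'] beta_e by (auto simp: st)
  \<comment> \<open>This edge shares its end in Y with e and its end in X with \<sigma> e, so it is
    the edge uy inserted by the move.\<close>
  have \<beta>e: "\<beta> e = (fst (\<sigma> e), snd e)"
    using keys(1)[of "\<beta> e"] keys(2)[of e] eH by (intro prod_eqI) auto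
  have s: "site_of e = ((fst a, snd e), state e, (fst (\<sigma> e), snd (\<sigma> e)))"
    by (simp add: site_of_def a_def)
  show "site_of e \<in> moves n d"
  proof -
    have "(fst (\<sigma> e), snd (\<sigma> e)) \<in> state e" "(fst (\<sigma> e), snd e) \<notin> state e"
      using in1 in2 unfolding \<beta>e by simp_all
    then show ?thesis unfolding s moves_def using Z lt by blast
  qed
  have "state (\<sigma> e) = sym_diff G (insert (\<beta> e) (insert (\<sigma> e) P))"
    using processed_next[OF ne'] by (simp add: state_def a_def[symmetric])
  also have "\<dots> = insert (\<beta> e) (state e - {\<sigma> e})"
    using beta_e sigma_e[OF ne'] by (auto simp: st)
  finally have "insert (fst (\<sigma> e), snd e) (state e - {\<sigma> e}) = state (\<sigma> e)" by (simp only: \<beta>e[symmetric])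
  then show "jump f (site_of e) = (level f e - level f (\<sigma> e))\<^sup>2"
    by (simp add: s jump_def level_def case_prod_unfold a_def)
qed

text \<open>The levels telescope along the component with code r. At the first edge
  \<open>fill\<close> puts back the start edge, at the last one it adds the closing G'-edge, and
  both times a regular graph between two complete trails results.\<close>

lemma level_sum:
  "f (sym_diff G (earlier H \<alpha> \<beta> r)) - f (sym_diff G (earlier H \<alpha> \<beta> (Suc r)))
    = (\<Sum>e | e \<in> H \<inter> G \<and> \<sigma> e \<noteq> start (cmp e) \<and> rank (cmp e) = r. level f e - level f (\<sigma> e))"
proof (cases "\<exists>e\<in>H. rank (cmp e) = r")
  case False
  then have "earlier H \<alpha> \<beta> (Suc r) = earlier H \<alpha> \<beta> r" by (auto simp: earlier_def less_Suc_eq)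
  moreover have none: "{e. e \<in> H \<inter> G \<and> \<sigma> e \<noteq> start (cmp e) \<and> rank (cmp e) = r} = {}" using False by auto
  ultimately show ?thesis unfolding none by simp
next
  case True
  then obtain e1 where e1: "e1 \<in> H" "rank (cmp e1) = r" by blast
  have "\<exists>e\<in>H \<inter> G. rank (cmp e) = r"
  proof (cases "e1 \<in> G")
    case False
    then have "\<beta> e1 \<in> H \<inter> G" using e1 colour(2)[of e1] by simp
    then show ?thesis using e1 by (intro bexI[of _ "\<beta> e1"]) auto
  qed (use e1 in blast)
  then obtain e0 where e0: "e0 \<in> H \<inter> G" "rank (cmp e0) = r" by blast
  define a where "a = start (cmp e0)"
  have a: "a \<in> H \<inter> G" "cmp a = cmp e0" using start[OF e0(1)] by (auto simp: a_def)
  \<comment> \<open>k is the number of G-edges of the closed trail. It has only k - 1 steps, because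
    after the last G-edge nothing is left to remove.\<close>
  define k where "k = (LEAST k. k > 0 \<and> (\<sigma> ^^ k) a = a)"
  have k: "k > 0" "(\<sigma> ^^ k) a = a"
    using LeastI_ex[of "\<lambda>k. k > 0 \<and> (\<sigma> ^^ k) a = a"] periodic[of a] a(1) unfolding k_def by auto
  have k_min: "(\<sigma> ^^ j) a \<noteq> a" if "0 < j" "j < k" for j
    using not_less_Least[of j "\<lambda>k. k > 0 \<and> (\<sigma> ^^ k) a = a"] that unfolding k_def by blast
  have neq: "(\<sigma> ^^ j) a \<noteq> (\<sigma> ^^ l) a" if "j < l" "l < k" for j l
  proof
    assume "(\<sigma> ^^ j) a = (\<sigma> ^^ l) a"
    then have "(\<sigma> ^^ (j + 0)) a = (\<sigma> ^^ (j + (l - j))) a" using that by simp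
    then have "(\<sigma> ^^ (l - j)) a = a" unfolding pow_cancel_add by simp
    then show False using k_min[of "l - j"] that by simp
  qed
  have inj: "inj_on (\<lambda>j. (\<sigma> ^^ j) a) {..<k}"
    by (rule linorder_inj_onI) (use neq in auto)
  have in_cmp: "rank (cmp e) = r \<longleftrightarrow> cmp e = cmp a" if "e \<in> H" for e
  proof
    assume "rank (cmp e) = r"
    then have "rank (cmp e) = rank (cmp a)" using e0 a by simp
    moreover have "finite (cmp e)" "finite (cmp a)"
      using comp_H that a(1) finite_H by (blast intro: finite_subset)+
    ultimately show "cmp e = cmp a" using inj_on_rank by (auto dest: inj_onD)
  qed (use e0 a in simp)
  have blue: "\<exists>j<k. e = (\<sigma> ^^ j) a" if eG: "e \<in> G" and ec: "cmp e = cmp a" for e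
  proof -
    have "e \<in> cmp a" using comp_refl[of e] unfolding ec .
    then obtain j where "e = (\<sigma> ^^ j) a" using comp_blue[OF a(1) _ eG] by blast
    then have "e = (\<sigma> ^^ (j mod k)) a" using funpow_mod_eq[OF k(2)] by simp
    then show ?thesis using k(1) by (intro exI[of _ "j mod k"]) simp
  qed
  have last: "\<sigma> ((\<sigma> ^^ j) a) = a \<longleftrightarrow> j = k - 1" if "j < k" for j
  proof -
    have "\<sigma> ((\<sigma> ^^ j) a) = (\<sigma> ^^ Suc j) a" by simp
    then show ?thesis using k k_min[of "Suc j"] that by (cases "Suc j = k") auto
  qed
  have idx: "{e. e \<in> H \<inter> G \<and> \<sigma> e \<noteq> start (cmp e) \<and> rank (cmp e) = r} = (\<lambda>j. (\<sigma> ^^ j) a) ` {..<k - 1}" (is "?A = ?B")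
  proof
    show "?A \<subseteq> ?B"
    proof
      fix e assume "e \<in> ?A"
      then have "e \<in> H" "e \<in> G" and se: "\<sigma> e \<noteq> start (cmp e)" and "rank (cmp e) = r" by blast+
      then have e: "e \<in> H" "e \<in> G" "cmp e = cmp a" using in_cmp by blast+
      then have "\<sigma> e \<noteq> a" using se a(2) by (simp add: a_def)
      note e = e this
      obtain j where j: "j < k" "e = (\<sigma> ^^ j) a" using blue[OF e(2,3)] by blast
      then have "j \<noteq> k - 1" using e(4) last[of j] by simp
      then show "e \<in> ?B" using j by auto
    qed
    show "?B \<subseteq> ?A"
    proof
      fix e assume "e \<in> ?B"
      then obtain j where j: "j < k - 1" "e = (\<sigma> ^^ j) a" by blast
      then have "\<sigma> e \<noteq> a" using last[of j] by simp
      moreover have "cmp e = cmp a" "e \<in> H \<inter> G" using j pow_G[OF a(1)] by auto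
      ultimately show "e \<in> ?A" using in_cmp[of e] a by (simp add: a_def)
    qed
  qed
  have inj': "inj_on (\<lambda>j. (\<sigma> ^^ j) a) {..<k - 1}" by (rule inj_on_subset[OF inj]) auto
  have "(\<Sum>e\<in>?B. level f e - level f (\<sigma> e)) = (\<Sum>j<k - 1. level f ((\<sigma> ^^ j) a) - level f ((\<sigma> ^^ Suc j) a))"
    by (subst sum.reindex[OF inj']) simp
  also have "\<dots> = level f a - level f ((\<sigma> ^^ (k - 1)) a)"
    using sum_lessThan_diff[of "\<lambda>j. level f ((\<sigma> ^^ j) a)" "k - 1"] by simp
  finally have tele: "(\<Sum>e\<in>?B. level f e - level f (\<sigma> e)) = level f a - level f ((\<sigma> ^^ (k - 1)) a)" .
  have st: "start (cmp a) = a" "rank (cmp a) = r" using a e0 by (simp_all add: a_def)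
  have ix: "index \<alpha> \<beta> a ((\<sigma> ^^ j) a) = j" if "j < k" for j
    unfolding index_def
  proof (rule Least_equality)
    fix l assume "(\<sigma> ^^ l) a = (\<sigma> ^^ j) a"
    then show "j \<le> l" using neq[of l j] that by (meson not_le)
  qed simp
  have notearly: "e \<notin> earlier H \<alpha> \<beta> r" if "cmp e = cmp a" for e
    using that st by (simp add: earlier_def)

  have "processed H \<alpha> \<beta> a a = insert a (earlier H \<alpha> \<beta> r)"
    using ix[of 0] k(1) by (simp add: processed_def trail_def st)
  then have s0: "state a = sym_diff G (earlier H \<alpha> \<beta> r) - {a}"
    using a(1) notearly[of a] by (auto simp: state_def st)
  have ain: "a \<in> sym_diff G (earlier H \<alpha> \<beta> r)" using a(1) notearly[of a] by auto
  have "(fst a, snd a) \<notin> state a" using s0 by simp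
  then have "fill (state a) (fst a) (snd a) = insert a (state a)"
    by (simp add: fill_def)
  also have "\<dots> = sym_diff G (earlier H \<alpha> \<beta> r)" using ain unfolding s0 by blast
  finally have "fill (state a) (fst a) (snd a) = sym_diff G (earlier H \<alpha> \<beta> r)" .
  then have L0: "level f a = f (sym_diff G (earlier H \<alpha> \<beta> r))" by (simp add: level_def st)

  \<comment> \<open>The G'-edge b after the last G-edge leads back to the first vertex, so it joins
    exactly the two deficient vertices and \<open>fill\<close> adds it.\<close>
  define e where "e = (\<sigma> ^^ (k - 1)) a"
  define b where "b = \<beta> e"
  have e: "e \<in> H" "e \<in> G" "cmp e = cmp a" using pow_G[OF a(1), of "k - 1"] by (auto simp: e_def)
  have b: "b \<in> H" "b \<notin> G" "cmp b = cmp a" using e colour(2)[of e] by (auto simp: b_def)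
  have "\<alpha> b = a" using last[of "k - 1"] k(1) by (simp add: b_def e_def)
  then have bkey: "b = (fst a, snd e)"
    using keys(1)[of b] keys(2)[of e] e b by (intro prod_eqI) (auto simp: b_def)
  have tr: "trail \<alpha> \<beta> a (k - 1) = cmp a - {b}"
  proof -
    have "x \<in> trail \<alpha> \<beta> a (k - 1) \<longleftrightarrow> x \<in> cmp a \<and> x \<noteq> b" for x
    proof
      assume "x \<in> trail \<alpha> \<beta> a (k - 1)"
      then consider j where "x = (\<sigma> ^^ j) a" | j where "j < k - 1" "x = \<beta> ((\<sigma> ^^ j) a)"
        by (auto simp: trail_def)
      then show "x \<in> cmp a \<and> x \<noteq> b"
      proof cases
        case (1 j)
        then show ?thesis using pow_G[OF a(1), of j] b comp_refl[of x] by auto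
      next
        case (2 j)
        then show ?thesis using neq[of j "k - 1"] k(1) comp_refl[of x] by (auto simp: b_def e_def inj_pair)
      qed
    next
      assume x: "x \<in> cmp a \<and> x \<noteq> b"
      have cx: "cmp x = cmp a" using comp_eq[of x a] x by simp
      have xH: "x \<in> H" using x comp_H[of a] a(1) by blast
      show "x \<in> trail \<alpha> \<beta> a (k - 1)"
      proof (cases "x \<in> G")
        case True
        then obtain j where "j < k" "x = (\<sigma> ^^ j) a" using blue cx by blast
        then show ?thesis unfolding trail_def by auto
      next
        case False
        then have "\<beta> x \<in> G" "cmp (\<beta> x) = cmp a" using colour(2)[OF xH] cx by auto
        then obtain j where j: "j < k" "\<beta> x = (\<sigma> ^^ j) a" using blue by blast
        then have xj: "x = \<beta> ((\<sigma> ^^ j) a)" by (metis invol(2))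
        then have "j \<noteq> k - 1" using x by (auto simp: b_def e_def)
        then show ?thesis unfolding trail_def using j(1) xj by auto
      qed
    qed
    then show ?thesis by blast
  qed
  have early: "earlier H \<alpha> \<beta> (Suc r) = earlier H \<alpha> \<beta> r \<union> cmp a"
  proof -
    have "x \<in> cmp a \<longleftrightarrow> x \<in> H \<and> rank (cmp x) = r" for x
      using in_cmp[of x] comp_eq[of x a] comp_refl[of x] comp_H[of a] a(1) by auto
    then show ?thesis unfolding earlier_def by (auto simp: less_Suc_eq)
  qed
  have "processed H \<alpha> \<beta> a e = earlier H \<alpha> \<beta> r \<union> (cmp a - {b})"
    using ix[of "k - 1"] k(1) tr by (simp add: processed_def st e_def)
  also have "\<dots> = earlier H \<alpha> \<beta> (Suc r) - {b}"
    using notearly[OF b(3)] early by auto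
  finally have s1: "state e = sym_diff G (earlier H \<alpha> \<beta> (Suc r)) - {b}"
    using b(2) e(3) by (auto simp: state_def st)
  have bin: "b \<in> sym_diff G (earlier H \<alpha> \<beta> (Suc r))"
    using b comp_refl[of b] by (auto simp: early)
  have "(fst a, snd e) \<notin> state e" unfolding s1 bkey[symmetric] by simp
  then have "fill (state e) (fst a) (snd e) = insert b (state e)"
    by (simp add: fill_def bkey)
  also have "\<dots> = sym_diff G (earlier H \<alpha> \<beta> (Suc r))" using bin unfolding s1 by blast
  finally have "fill (state e) (fst a) (snd e) = sym_diff G (earlier H \<alpha> \<beta> (Suc r))" .
  then have L1: "level f e = f (sym_diff G (earlier H \<alpha> \<beta> (Suc r)))" by (simp add: level_def st e(3))
  show ?thesis unfolding idx tele using L0 L1 by (simp add: e_def)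
qed

definition steps :: "(nat \<times> nat) set" where
  "steps = {e \<in> H \<inter> G. \<sigma> e \<noteq> start (cmp e)}"

lemma finite_steps: "finite steps"
  using finite_H by (auto simp: steps_def)

lemma telescope: "f G - f G' = (\<Sum>e\<in>steps. level f e - level f (\<sigma> e))"
proof -
  define R where "R = Suc (Max (insert 0 ((\<lambda>e. rank (cmp e)) ` H)))"
  have R: "rank (cmp e) < R" if "e \<in> H" for e
    using that finite_H by (auto simp: R_def less_Suc_eq_le)
  let ?D = "\<lambda>r. f (sym_diff G (earlier H \<alpha> \<beta> r))"
  have "(\<Sum>e\<in>steps. level f e - level f (\<sigma> e))
    = (\<Sum>r<R. \<Sum>e\<in>{e \<in> steps. rank (cmp e) = r}. level f e - level f (\<sigma> e))"
    using finite_steps R by (intro sum.group[symmetric]) (auto simp: steps_def)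
  also have "\<dots> = (\<Sum>r<R. ?D r - ?D (Suc r))"
    unfolding level_sum by (intro sum.cong refl) (auto simp: steps_def)
  also have "\<dots> = ?D 0 - ?D R" by (rule sum_lessThan_diff)
  also have "earlier H \<alpha> \<beta> 0 = {}" by (simp add: earlier_def)
  also have "earlier H \<alpha> \<beta> R = H" using R by (auto simp: earlier_def)
  also have "sym_diff G H = G'" by (auto simp: H_def)
  finally show ?thesis by simp
qed

text \<open>Cauchy-Schwarz along the path; steps are indexed by edges of G, so there are at most d
  n.\<close>

lemma square_le_jumps: "(f G - f G')\<^sup>2 \<le> real (d * n) * (\<Sum>e\<in>steps. jump f (site_of e))"
proof -
  have "(f G - f G')\<^sup>2 \<le> real (card steps) * (\<Sum>e\<in>steps. (level f e - level f (\<sigma> e))\<^sup>2)"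
    unfolding telescope by (subst mult.commute) (rule sum_squared_le_sum_of_squares)
  also have "(\<Sum>e\<in>steps. (level f e - level f (\<sigma> e))\<^sup>2) = (\<Sum>e\<in>steps. jump f (site_of e))"
    by (intro sum.cong refl site_move(2)[symmetric]) (auto simp: steps_def)
  also have "card steps \<le> d * n"
    using card_mono[OF regular_bip_finite[OF G], of steps] card_regular_bip[OF G] by (auto simp: steps_def)
  then have "real (card steps) * (\<Sum>e\<in>steps. jump f (site_of e)) \<le> real (d * n) * (\<Sum>e\<in>steps. jump f (site_of e))"
    by (intro mult_right_mono sum_nonneg) (simp_all add: jump_def case_prod_unfold del: of_nat_mult)
  finally show ?thesis .
qed

end

section \<open>Congestion\<close>

definition pairing_pairs :: "bgraph \<times> bgraph \<Rightarrow> ((nat \<times> nat \<Rightarrow> nat \<times> nat) \<times> (nat \<times> nat \<Rightarrow> nat \<times> nat)) set" where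
  "pairing_pairs p = pairings fst (fst p) (sym_diff (fst p) (snd p)) \<times> pairings snd (fst p) (sym_diff (fst p) (snd p))"

lemma balanced_sym_diff:
  assumes "finite G" "finite G'" "deg k G v = deg k G' v"
  shows "deg k (sym_diff G G' \<inter> G) v = deg k (sym_diff G G' - G) v"
proof -
  have "deg k ((G \<inter> G') \<union> (G - G')) v = deg k (G \<inter> G') v + deg k (G - G') v"
    "deg k ((G \<inter> G') \<union> (G' - G)) v = deg k (G \<inter> G') v + deg k (G' - G) v"
    using assms by (intro deg_Un_disjoint; auto)+
  moreover have "(G \<inter> G') \<union> (G - G') = G" "(G \<inter> G') \<union> (G' - G) = G'"
    "sym_diff G G' \<inter> G = G - G'" "sym_diff G G' - G = G' - G" by auto
  ultimately show ?thesis using assms by simp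
qed

lemma deg_outside:
  assumes "G \<in> regular_bip n d" "\<not> v < n" shows "deg fst G v = 0" "deg snd G v = 0"
proof -
  have "{e \<in> G. fst e = v} = {}" "{e \<in> G. snd e = v} = {}"
    using assms by (auto simp: regular_bip_def)
  then show "deg fst G v = 0" "deg snd G v = 0" by (simp_all only: deg_def card.empty)
qed

lemma pairing_pairs:
  assumes "G \<in> regular_bip n d" "G' \<in> regular_bip n d"
  shows "pairing_pairs (G, G') \<noteq> {}" "finite (pairing_pairs (G, G'))"
proof -
  have fin: "finite G" "finite G'" using assms by (auto intro: regular_bip_finite)
  then show "finite (pairing_pairs (G, G'))"
    by (auto simp: pairing_pairs_def intro!: finite_pairings)
  have "deg fst G v = deg fst G' v" "deg snd G v = deg snd G' v" for v
    using assms deg_outside[of _ n d v] by (cases "v < n"; simp add: regular_bip_iff)+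
  then have "pairings fst G (sym_diff G G') \<noteq> {}" "pairings snd G (sym_diff G G') \<noteq> {}"
    using fin by (intro pairings_nonempty balanced_sym_diff; simp)+
  then show "pairing_pairs (G, G') \<noteq> {}" by (simp add: pairing_pairs_def)
qed

lemma regular_pair:
  assumes "G \<in> regular_bip n d" "G' \<in> regular_bip n d" "\<gamma> \<in> pairing_pairs (G, G')"
  shows "regular_pair n d G G' (fst \<gamma>) (snd \<gamma>)"
  using assms by unfold_locales (auto simp: pairing_pairs_def)

section \<open>Codes of path steps\<close>

definition transitions :: "nat \<Rightarrow> nat \<Rightarrow>
    ((bgraph \<times> bgraph) \<times> ((nat \<times> nat \<Rightarrow> nat \<times> nat) \<times> (nat \<times> nat \<Rightarrow> nat \<times> nat)) \<times> (nat \<times> nat)) set" where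
  "transitions n d = (SIGMA p:regular_bip n d \<times> regular_bip n d. SIGMA \<gamma>:pairing_pairs p.
    regular_pair.steps (fst p) (snd p) (fst \<gamma>) (snd \<gamma>))"

text \<open>All conditions refer to the code itself and not to G and G', so codes can be counted.
  The two marked edges lie at the vertices of degree d + 1 in L, and the pairings belong to the
  colouring by Z with one marked edge restored on each side.\<close>

definition codes :: "nat \<Rightarrow> nat \<Rightarrow>
    (site \<times> bgraph \<times> ((nat \<times> nat) \<times> (nat \<times> nat)) \<times> ((nat \<times> nat \<Rightarrow> nat \<times> nat) \<times> (nat \<times> nat \<Rightarrow> nat \<times> nat))) set" where
  "codes n d = (SIGMA t:moves n d. SIGMA L:surplus n d (fst (fst t)) (snd (fst t)).
    SIGMA c:{a \<in> L. fst a = fst (fst t)} \<times> {e \<in> L. snd e = snd (fst t)}.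
      pairings fst (insert (fst c) (fst (snd t))) (sym_diff (fst (snd t)) L)
      \<times> pairings snd (insert (snd c) (fst (snd t))) (sym_diff (fst (snd t)) L))"

text \<open>The jump is shared equally among the codes that differ only in their pairings.\<close>

definition code_weight where
  "code_weight f = (\<lambda>(t, L, c, _). jump f t /
    real (card (pairings fst (insert (fst c) (fst (snd t))) (sym_diff (fst (snd t)) L)
      \<times> pairings snd (insert (snd c) (fst (snd t))) (sym_diff (fst (snd t)) L))))"

definition encode where
  "encode = (\<lambda>(p, \<gamma>, e). (regular_pair.site_of (fst p) (snd p) (fst \<gamma>) (snd \<gamma>) e,
    regular_pair.costate (fst p) (snd p) (fst \<gamma>) (snd \<gamma>) e,
    (regular_pair.start (fst p) (component (fst \<gamma>) (snd \<gamma>) e), e), \<gamma>))"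

text \<open>The processed set is computed from H = Z \<triangle> L, the pairings and the two end
  edges; flipping it in Z and L gives back G and G'.\<close>

definition decode where
  "decode = (\<lambda>(t :: site, L, c, \<gamma>).
    let Z = fst (snd t); P = processed (sym_diff Z L) (fst \<gamma>) (snd \<gamma>) (fst c) (snd c)
    in ((sym_diff Z P, sym_diff L P), \<gamma>, snd c))"

lemma jump_nonneg: "0 \<le> jump f t"
  by (simp add: jump_def case_prod_unfold)

text \<open>The colourings of H by G and by the completed state both admit pairings, hence equally
  many; so the weight of a code is the share of one pairing in the average over all pairings for (G,
  G').\<close>

lemma encode_properties:
  assumes q: "q \<in> transitions n d"
  shows "encode q \<in> codes n d" "decode (encode q) = q"
    "code_weight f (encode q) = jump f (fst (encode q)) / real (card (pairing_pairs (fst q)))"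
proof -
  obtain G G' \<alpha> \<beta> e where q': "q = ((G, G'), (\<alpha>, \<beta>), e)"
    by (metis surj_pair)
  then have mem: "G \<in> regular_bip n d" "G' \<in> regular_bip n d" "(\<alpha>, \<beta>) \<in> pairing_pairs (G, G')"
      "e \<in> regular_pair.steps G G' \<alpha> \<beta>"
    using q by (simp_all add: transitions_def)
  interpret regular_pair n d G G' \<alpha> \<beta> using regular_pair[OF mem(1-3)] by simp
  have e: "e \<in> H \<inter> G" "\<sigma> e \<noteq> start (cmp e)" using mem(4) by (auto simp: steps_def)
  note st = state_properties[OF e(1)]
  have enc: "encode q = (((fst (start (cmp e)), snd e), state e, \<sigma> e), costate e, (start (cmp e), e), (\<alpha>, \<beta>))"
    by (simp add: encode_def q' site_of_def)
  have "((fst (start (cmp e)), snd e), state e, \<sigma> e) \<in> moves n d"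
    using site_move(1)[OF e] by (simp add: site_of_def)
  then show "encode q \<in> codes n d"
    unfolding enc codes_def using st by (simp del: comp_apply)
  let ?P = "processed H \<alpha> \<beta> (start (cmp e)) e"
  have "sym_diff (state e) ?P = G" "sym_diff (costate e) ?P = G'"
    by (auto simp: state_def costate_def)
  then show "decode (encode q) = q"
    unfolding enc decode_def using st(7) by (simp add: q' Let_def)
  have ne: "pairings fst G H \<noteq> {}" "pairings snd G H \<noteq> {}"
    using mem(3) by (auto simp: pairing_pairs_def H_def)
  have "card (pairings fst (insert (start (cmp e)) (state e)) H) = card (pairings fst G H)"
    "card (pairings snd (insert e (state e)) H) = card (pairings snd G H)"
    using st(5,6) ne by (intro card_pairings_eq[OF finite_H]; blast)+
  then show "code_weight f (encode q) = jump f (fst (encode q)) / real (card (pairing_pairs (fst q)))"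
    unfolding enc code_weight_def using st(7)
    by (simp add: q' pairing_pairs_def card_cartesian_product H_def[symmetric] del: comp_apply)
qed

lemma finite_codes_parts:
  assumes "t \<in> moves n d" "L \<in> surplus n d x y"
  shows "finite (pairings k c (sym_diff (fst (snd t)) L))"
  using assms by (intro finite_pairings) (auto simp: moves_def dest: deficit_finite surplus_finite)

lemma finite_codes: "finite (codes n d)"
  unfolding codes_def
  by (intro finite_SigmaI finite_moves finite_surplus finite_cartesian_product finite_codes_parts)
    (auto dest: surplus_finite)

lemma sum_code_weight_le:
  "(\<Sum>r\<in>codes n d. code_weight f r)
    \<le> real ((d + 1)\<^sup>2 * ((d * n + 1) * card (regular_bip n d))) * (\<Sum>t\<in>moves n d. jump f t)"
proof -
  let ?N = "(d * n + 1) * card (regular_bip n d)"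
  let ?C = "\<lambda>t L. {a \<in> L. fst a = fst (fst t)} \<times> {e \<in> L. snd e = snd (fst t)}"
  let ?\<Gamma> = "\<lambda>t L c. pairings fst (insert (fst c) (fst (snd t))) (sym_diff (fst (snd t)) L)
      \<times> pairings snd (insert (snd c) (fst (snd t))) (sym_diff (fst (snd t)) L)"
  have "(\<Sum>r\<in>codes n d. code_weight f r)
    = (\<Sum>t\<in>moves n d. \<Sum>r\<in>(SIGMA L:surplus n d (fst (fst t)) (snd (fst t)). SIGMA c:?C t L. ?\<Gamma> t L c). code_weight f (t, r))"
    unfolding codes_def
    by (intro sum_Sigma finite_SigmaI finite_moves finite_surplus finite_cartesian_product finite_codes_parts)
      (auto dest: surplus_finite)
  also have "\<dots> \<le> (\<Sum>t\<in>moves n d. real ((d + 1)\<^sup>2 * ?N) * jump f t)"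
  proof (rule sum_mono)
    fix t :: site assume t: "t \<in> moves n d"
    let ?S = "surplus n d (fst (fst t)) (snd (fst t))"
    have xy: "fst (fst t) < n" "snd (fst t) < n" using t by (auto simp: moves_def)
    have "(\<Sum>r\<in>(SIGMA L:?S. SIGMA c:?C t L. ?\<Gamma> t L c). code_weight f (t, r))
      = (\<Sum>L\<in>?S. \<Sum>s\<in>(SIGMA c:?C t L. ?\<Gamma> t L c). code_weight f (t, L, s))"
      by (intro sum_Sigma finite_SigmaI finite_surplus finite_cartesian_product finite_codes_parts[OF t])
        (auto dest: surplus_finite)
    also have "\<dots> \<le> (\<Sum>L\<in>?S. real ((d + 1)\<^sup>2) * jump f t)"
    proof (rule sum_mono)
      fix L assume L: "L \<in> ?S"
      have "(\<Sum>s\<in>(SIGMA c:?C t L. ?\<Gamma> t L c). code_weight f (t, L, s))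
        = (\<Sum>c\<in>?C t L. \<Sum>\<gamma>\<in>?\<Gamma> t L c. code_weight f (t, L, c, \<gamma>))"
        using L by (intro sum_Sigma finite_cartesian_product finite_codes_parts[OF t]) (auto dest: surplus_finite)
      also have "\<dots> \<le> (\<Sum>c\<in>?C t L. jump f t)"
      proof (rule sum_mono)
        fix c
        have "(\<Sum>\<gamma>\<in>?\<Gamma> t L c. code_weight f (t, L, c, \<gamma>))
          = (\<Sum>\<gamma>\<in>?\<Gamma> t L c. jump f t / real (card (?\<Gamma> t L c)))"
          by (intro sum.cong refl) (simp add: code_weight_def)
        \<comment> \<open>Equality holds unless the cardinality is 0, when the left side
          vanishes.\<close>
        also have "\<dots> \<le> jump f t"
          using jump_nonneg[of f t] unfolding sum_constant by (cases "card (?\<Gamma> t L c) = 0") simp_all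
        finally show "(\<Sum>\<gamma>\<in>?\<Gamma> t L c. code_weight f (t, L, c, \<gamma>)) \<le> jump f t" .
      qed
      also have "\<dots> = real (card (?C t L)) * jump f t" by simp
      also have "card (?C t L) = (d + 1)\<^sup>2"
      proof -
        have "deg fst L (fst (fst t)) = d + 1" "deg snd L (snd (fst t)) = d + 1"
          using L xy by (simp_all add: surplus_def)
        then show ?thesis by (simp add: card_cartesian_product deg_def power2_eq_square)
      qed
      finally show "(\<Sum>s\<in>(SIGMA c:?C t L. ?\<Gamma> t L c). code_weight f (t, L, s)) \<le> real ((d + 1)\<^sup>2) * jump f t" .
    qed
    also have "\<dots> = real (card ?S) * (real ((d + 1)\<^sup>2) * jump f t)" by simp
    also have "\<dots> \<le> real ?N * (real ((d + 1)\<^sup>2) * jump f t)"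
      using card_surplus_le[OF xy, of d] jump_nonneg[of f t]
      by (intro mult_right_mono) (simp_all only: of_nat_le_iff, simp)
    finally show "(\<Sum>r\<in>(SIGMA L:?S. SIGMA c:?C t L. ?\<Gamma> t L c). code_weight f (t, r))
        \<le> real ((d + 1)\<^sup>2 * ?N) * jump f t"
      by (simp only: of_nat_mult mult_ac)
  qed
  finally show ?thesis by (simp only: sum_distrib_left)
qed

lemma sum_squares_le_jumps:
  "(\<Sum>G\<in>regular_bip n d. \<Sum>G'\<in>regular_bip n d. (f G - f G')\<^sup>2)
    \<le> real (d * n) * (real ((d + 1)\<^sup>2 * ((d * n + 1) * card (regular_bip n d))) * (\<Sum>t\<in>moves n d. jump f t))"
proof -
  let ?\<Omega> = "regular_bip n d"
  let ?st = "\<lambda>p \<gamma>. regular_pair.steps (fst p) (snd p) (fst \<gamma>) (snd \<gamma>)"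
  let ?h = "\<lambda>p \<gamma> e. jump f (fst (encode (p, \<gamma>, e))) / real (card (pairing_pairs p))"
  have pair: "(f (fst p) - f (snd p))\<^sup>2 \<le> real (d * n) * (\<Sum>\<gamma>\<in>pairing_pairs p. \<Sum>e\<in>?st p \<gamma>. ?h p \<gamma> e)"
    if p: "p \<in> ?\<Omega> \<times> ?\<Omega>" for p
  proof -
    obtain G G' where G: "p = (G, G')" "G \<in> ?\<Omega>" "G' \<in> ?\<Omega>" using p by blast
    define c where "c = real (card (pairing_pairs p))"
    have c: "c > 0" using pairing_pairs[OF G(2,3)] by (simp add: c_def G(1) card_gt_0_iff)
    have "(f G - f G')\<^sup>2 \<le> real (d * n) * (\<Sum>e\<in>?st p \<gamma>. jump f (fst (encode (p, \<gamma>, e))))"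
      if "\<gamma> \<in> pairing_pairs p" for \<gamma>
      using regular_pair.square_le_jumps[OF regular_pair[OF G(2,3)], of \<gamma> f] that
      by (simp add: G(1) encode_def)
    then have "(\<Sum>\<gamma>\<in>pairing_pairs p. (f G - f G')\<^sup>2)
      \<le> (\<Sum>\<gamma>\<in>pairing_pairs p. real (d * n) * (\<Sum>e\<in>?st p \<gamma>. jump f (fst (encode (p, \<gamma>, e)))))"
      by (rule sum_mono)
    then have "c * (f G - f G')\<^sup>2
      \<le> real (d * n) * (\<Sum>\<gamma>\<in>pairing_pairs p. \<Sum>e\<in>?st p \<gamma>. jump f (fst (encode (p, \<gamma>, e))))"
      by (simp add: c_def sum_distrib_left)
    then have "(f G - f G')\<^sup>2
      \<le> real (d * n) * (\<Sum>\<gamma>\<in>pairing_pairs p. \<Sum>e\<in>?st p \<gamma>. jump f (fst (encode (p, \<gamma>, e)))) / c"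
      using c by (simp add: pos_le_divide_eq mult.commute)
    then show ?thesis by (simp add: G(1) c_def flip: sum_divide_distrib)
  qed
  have fin: "finite (?st p \<gamma>)" if "p \<in> ?\<Omega> \<times> ?\<Omega>" "\<gamma> \<in> pairing_pairs p" for p \<gamma>
    using that regular_pair.finite_steps[OF regular_pair, of "fst p" n d "snd p" \<gamma>] by auto
  have fp: "finite (pairing_pairs p)" if "p \<in> ?\<Omega> \<times> ?\<Omega>" for p
    using that pairing_pairs(2) by auto
  have "(\<Sum>G\<in>?\<Omega>. \<Sum>G'\<in>?\<Omega>. (f G - f G')\<^sup>2) = (\<Sum>p\<in>?\<Omega> \<times> ?\<Omega>. (f (fst p) - f (snd p))\<^sup>2)"
    by (simp add: sum.cartesian_product case_prod_unfold)
  also have "\<dots> \<le> (\<Sum>p\<in>?\<Omega> \<times> ?\<Omega>. real (d * n) * (\<Sum>\<gamma>\<in>pairing_pairs p. \<Sum>e\<in>?st p \<gamma>. ?h p \<gamma> e))"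
    by (rule sum_mono) (rule pair)
  also have "\<dots> = real (d * n) * (\<Sum>p\<in>?\<Omega> \<times> ?\<Omega>. \<Sum>\<gamma>\<in>pairing_pairs p. \<Sum>e\<in>?st p \<gamma>. ?h p \<gamma> e)"
    by (simp only: sum_distrib_left)
  also have "(\<Sum>p\<in>?\<Omega> \<times> ?\<Omega>. \<Sum>\<gamma>\<in>pairing_pairs p. \<Sum>e\<in>?st p \<gamma>. ?h p \<gamma> e)
    = (\<Sum>q\<in>transitions n d. jump f (fst (encode q)) / real (card (pairing_pairs (fst q))))"
  proof -
    have "(\<Sum>q\<in>transitions n d. jump f (fst (encode q)) / real (card (pairing_pairs (fst q))))
      = (\<Sum>p\<in>?\<Omega> \<times> ?\<Omega>. \<Sum>r\<in>(SIGMA \<gamma>:pairing_pairs p. ?st p \<gamma>). ?h p (fst r) (snd r))"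
      unfolding transitions_def
      by (subst sum_Sigma) (auto intro!: finite_SigmaI finite_cartesian_product finite_regular_bip fin fp)
    also have "\<dots> = (\<Sum>p\<in>?\<Omega> \<times> ?\<Omega>. \<Sum>\<gamma>\<in>pairing_pairs p. \<Sum>e\<in>?st p \<gamma>. ?h p \<gamma> e)"
      by (intro sum.cong refl, subst sum_Sigma) (auto intro!: fin fp)
    finally show ?thesis by simp
  qed
  also have "\<dots> = (\<Sum>q\<in>transitions n d. code_weight f (encode q))"
    by (intro sum.cong refl) (simp add: encode_properties(3))
  also have "\<dots> \<le> (\<Sum>r\<in>codes n d. code_weight f r)"
  proof (rule sum_inj_le)
    show "inj_on encode (transitions n d)"
      by (rule inj_on_inverseI[of _ decode]) (rule encode_properties(2))
    show "encode ` transitions n d \<subseteq> codes n d" using encode_properties(1) by blast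
    show "0 \<le> code_weight f r" for r by (simp add: code_weight_def case_prod_unfold jump_nonneg)
  qed (rule finite_codes)
  also note sum_code_weight_le
  finally show ?thesis by (simp only: mult_left_mono of_nat_0_le_iff)
qed

section \<open>The mixing time\<close>

text \<open>With at most one edge there is at most one graph. The general estimate divides by the
  number of edge pairs and does not cover this case.\<close>

lemma mixing_time_trivial:
  assumes "d * n \<le> 1" "0 < \<epsilon>"
  shows "mixing_time (regular_bip n d) \<epsilon> = 0"
proof -
  let ?\<Omega> = "regular_bip n d"
  have "(LEAST T. \<forall>t\<ge>T. dtv_unif ?\<Omega> (Pt ?\<Omega> t B) \<le> \<epsilon>) = 0" if B: "B \<in> ?\<Omega>" for B
  proof -
    have small: "card C \<le> 1" if "C \<in> ?\<Omega>" for C using card_regular_bip[OF that] assms(1) by simp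
    have "C = B" if C: "C \<in> ?\<Omega>" for C
    proof (cases "d * n = 0")
      case True
      then have "card C = 0" "card B = 0" using card_regular_bip[OF C] card_regular_bip[OF B] by simp_all
      then show ?thesis using card_0_eq regular_bip_finite[OF C] regular_bip_finite[OF B] by blast
    next
      case False
      then have "d * n = 1" using assms(1) by linarith
      then have dn: "d = 1" "n = 1" by auto
      have single: "D = {(0, 0)}" if D: "D \<in> regular_bip n d" for D
      proof -
        have "D \<subseteq> {(0, 0)}" "D \<noteq> {}"
          using D card_regular_bip[OF D] by (auto simp: regular_bip_def dn)
        then show ?thesis by blast
      qed
      show ?thesis using single[OF B] single[OF C] by simp
    qed
    then have \<Omega>: "?\<Omega> = {B}" using B by blast
    have "edge_pairs B = {}"
      using small[OF B] card_edge_pairs[OF regular_bip_finite[OF B]] finite_edge_pairs[OF regular_bip_finite[OF B]]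
      by (cases "card B = 0") auto
    then have P: "switch_P B B = 1" by (simp add: switch_P_def)
    have "Pt {B} t B B = 1" for t by (induction t) (simp_all add: P)
    then have "dtv_unif ?\<Omega> (Pt ?\<Omega> t B) = 0" for t by (simp add: \<Omega> dtv_unif_def)
    then show ?thesis using assms(2) by (intro Least_equality) auto
  qed
  then have "(\<lambda>B. LEAST T. \<forall>t\<ge>T. dtv_unif ?\<Omega> (Pt ?\<Omega> t B) \<le> \<epsilon>) ` ?\<Omega> \<subseteq> {0}" by auto
  then have "insert 0 ((\<lambda>B. LEAST T. \<forall>t\<ge>T. dtv_unif ?\<Omega> (Pt ?\<Omega> t B) \<le> \<epsilon>) ` ?\<Omega>) = {0}" by auto
  then show ?thesis by (simp only: mixing_time_def Max_singleton)
qed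

text \<open>It compares the sum of all jumps with the total energy and equals 1 for d = 1.\<close>

definition congestion :: "nat \<Rightarrow> nat \<Rightarrow> real" where
  "congestion n d = 1 + (2 + 4 * real d) * (real (d - 1) * (2 * (1 + real (d * n)) * real (n * d ^ 3)))"

lemma sum_jump_le_energy:
  "(\<Sum>t\<in>moves n d. jump f t) \<le> congestion n d * (\<Sum>B\<in>regular_bip n d. energy f B)"
proof -
  have "(2 + 4 * real d) * (\<Sum>t\<in>crowded n d. detour f t)
    \<le> (2 + 4 * real d) * (real (d - 1) * (2 * (1 + real (d * n)) * real (n * d ^ 3))
      * (\<Sum>B\<in>regular_bip n d. energy f B))"
    by (intro mult_left_mono sum_detour_le) simp
  then show ?thesis using sum_jump_le[of f n d] by (simp add: congestion_def algebra_simps)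
qed

lemma congestion_le:
  assumes "2 \<le> d * n"
  shows "2 * (real (d * n) * (real (d * n) - 1)) * real (d * n) * (real ((d + 1)\<^sup>2) * real (d * n + 1)) * congestion n d
    \<le> 32 * real d ^ 17 * real n ^ 6"
proof -
  define D N where "D = real d" and "N = real n"
  have pos: "d \<ge> 1" "n \<ge> 1" using assms by (auto simp: Suc_le_eq intro: Nat.gr0I)
  then have DN: "D \<ge> 1" "N \<ge> 1" by (auto simp: D_def N_def)
  have m: "D * N \<ge> 2" using assms by (simp add: D_def N_def flip: of_nat_mult)
  have m0: "0 \<le> D * N" using m by linarith
  have P: "D * N * (D * N - 1) \<le> (D * N) * (D * N)" using m0 by (intro mult_left_mono) auto
  have goal: "2 * (D * N * (D * N - 1)) * (D * N) * ((D + 1)\<^sup>2 * (D * N + 1)) * congestion n d \<le> 32 * D ^ 17 * N ^ 6"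
  proof (cases "d = 1")
    case True
    have "2 * (N * (N - 1)) * N * (4 * (N + 1)) \<le> 2 * (N * N) * N * (4 * (N + N))"
      using DN by (intro mult_mono) auto
    also have "\<dots> = 16 * N ^ 4" by (simp add: power4_eq_xxxx)
    also have "\<dots> \<le> 32 * N ^ 6"
    proof -
      have "N ^ 4 \<le> N ^ 6" "0 \<le> N ^ 6" using DN power_increasing[of 4 6 N] by simp_all
      then show ?thesis by linarith
    qed
    finally show ?thesis using True by (simp add: D_def congestion_def)
  next
    case False
    then have D2: "D \<ge> 2" using pos by (simp add: D_def)
    have c: "congestion n d = 1 + (2 + 4 * D) * ((D - 1) * (2 * (1 + D * N) * (N * D ^ 3)))"
      using pos by (simp add: congestion_def D_def N_def of_nat_diff)
    have "(2 + 4 * D) * (D - 1) \<le> 4 * D\<^sup>2" using D2 by (simp add: power2_eq_square algebra_simps)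
    moreover have "2 * (1 + D * N) \<le> 3 * (D * N)" unfolding distrib_left using m by linarith
    then have "2 * (1 + D * N) * (N * D ^ 3) \<le> 3 * (D * N) * (N * D ^ 3)"
      using DN by (intro mult_right_mono) auto
    moreover have "0 \<le> 2 * (1 + D * N) * (N * D ^ 3)" using DN m0 by simp
    ultimately have "((2 + 4 * D) * (D - 1)) * ((2 * (1 + D * N)) * (N * D ^ 3)) \<le> (4 * D\<^sup>2) * ((3 * (D * N)) * (N * D ^ 3))"
      by (intro mult_mono[where c = "2 * (1 + D * N) * (N * D ^ 3)"]) simp_all
    then have "congestion n d \<le> 1 + 12 * (N\<^sup>2 * D ^ 6)"
      unfolding c by (simp add: power2_eq_square power3_eq_cube mult_ac numeral_eq_Suc)
    moreover have "1 \<le> N\<^sup>2 * D ^ 6" using DN mult_mono[of 1 "N\<^sup>2" 1 "D ^ 6"] by simp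
    ultimately have c13: "congestion n d \<le> 13 * (N\<^sup>2 * D ^ 6)" by linarith
    have c0: "0 \<le> congestion n d" unfolding c using DN m0 by simp
    have s: "(D + 1)\<^sup>2 \<le> 9 / 4 * D\<^sup>2"
    proof -
      have "(D + 1)\<^sup>2 \<le> (3 / 2 * D)\<^sup>2" using D2 by (intro power_mono) auto
      then show ?thesis by (simp add: power_mult_distrib power_divide)
    qed
    have "2 * (D * N * (D * N - 1)) * (D * N) * ((D + 1)\<^sup>2 * (D * N + 1)) * congestion n d
      \<le> 2 * ((D * N) * (D * N)) * (D * N) * ((9 / 4 * D\<^sup>2) * (3 / 2 * (D * N))) * (13 * (N\<^sup>2 * D ^ 6))"
      using m m0 P s c13 c0 DN by (intro mult_mono mult_nonneg_nonneg) auto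
    \<comment> \<open>351/4 = 2 * 9/4 * 3/2 * 13, where 9/4 and 3/2 bound (D + 1)^2 / D^2 and (D N +
      1) / (D N) for D >= 2 and D N >= 2, and 13 is the constant of \<open>congestion\<close>. It is
      dominated by 32 D^5, as D^5 >= 32.\<close>
    also have "\<dots> = (351 / 4) * (D ^ 12 * N ^ 6)"
      by (simp add: power2_eq_square numeral_eq_Suc mult_ac)
    also have "\<dots> \<le> (32 * D ^ 5) * (D ^ 12 * N ^ 6)"
    proof -
      have "2 ^ 5 \<le> D ^ 5" using D2 by (intro power_mono) auto
      then show ?thesis using DN by (intro mult_right_mono) auto
    qed
    also have "\<dots> = 32 * D ^ 17 * N ^ 6" by (simp flip: power_add)
    finally show ?thesis .
  qed
  then show ?thesis
    unfolding D_def N_def by (simp only: of_nat_mult of_nat_add of_nat_1 of_nat_power)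
qed

text \<open>For mean zero the squared differences over all pairs of states sum to 2 N V. One factor
  N cancels against the number of surplus graphs, which is at most a multiple of N.\<close>

lemma (in switch_chain) poincare:
  assumes "sum g \<Omega> = 0"
  shows "(\<Sum>B\<in>\<Omega>. (g B)\<^sup>2) \<le> 32 * real d ^ 17 * real n ^ 6
    * ((\<Sum>B\<in>\<Omega>. (g B)\<^sup>2) - (\<Sum>B\<in>\<Omega>. \<Sum>B'\<in>\<Omega>. g B * switch_P B B' * g B'))"
proof (cases "\<Omega> = {}")
  case False
  define N where "N = real (card \<Omega>)"
  have N: "N > 0" using False finite_regular_bip by (simp add: N_def card_gt_0_iff)
  define V S where "V = (\<Sum>B\<in>\<Omega>. (g B)\<^sup>2)" and "S = (\<Sum>B\<in>\<Omega>. energy g B)"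
  have S0: "0 \<le> S" unfolding S_def by (intro sum_nonneg energy_nonneg)
  have "(\<Sum>G\<in>\<Omega>. \<Sum>G'\<in>\<Omega>. (g G - g G')\<^sup>2) = (\<Sum>G\<in>\<Omega>. N * (g G)\<^sup>2 + V - 2 * g G * sum g \<Omega>)"
    by (intro sum.cong refl)
      (simp add: power2_diff sum.distrib sum_subtractf N_def V_def flip: sum_distrib_left)
  also have "\<dots> = 2 * N * V"
    by (simp add: assms sum.distrib N_def V_def flip: sum_distrib_left)
  finally have var: "(\<Sum>G\<in>\<Omega>. \<Sum>G'\<in>\<Omega>. (g G - g G')\<^sup>2) = 2 * N * V" .
  define c where "c = real (d * n) * (real ((d + 1)\<^sup>2) * real (d * n + 1))"
  have "2 * N * V \<le> real (d * n) * (real ((d + 1)\<^sup>2 * ((d * n + 1) * card \<Omega>)) * (\<Sum>t\<in>moves n d. jump g t))"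
    unfolding var[symmetric] by (rule sum_squares_le_jumps)
  also have "\<dots> \<le> real (d * n) * (real ((d + 1)\<^sup>2 * ((d * n + 1) * card \<Omega>)) * (congestion n d * S))"
    unfolding S_def by (intro mult_left_mono sum_jump_le_energy) auto
  also have "\<dots> = N * (c * congestion n d * S)"
    unfolding N_def c_def of_nat_mult by (simp only: mult_ac)
  finally have "N * (2 * V) \<le> N * (c * congestion n d * S)" by (simp only: mult_ac)
  then have "2 * V \<le> c * congestion n d * S" using N by (simp only: mult_le_cancel_left_pos)
  also have "S = 4 * pairs * (V - (\<Sum>B\<in>\<Omega>. \<Sum>B'\<in>\<Omega>. g B * switch_P B B' * g B'))" (is "_ = 4 * pairs * ?D")
    using dirichlet_form[of g] pairs_pos by (simp add: S_def V_def)
  also have "c * congestion n d * (4 * pairs * ?D) = 2 * (2 * pairs * c * congestion n d * ?D)" by simp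
  finally have "V \<le> 2 * pairs * c * congestion n d * ?D" by linarith
  also have "\<dots> \<le> 32 * real d ^ 17 * real n ^ 6 * ?D"
  proof (rule mult_right_mono)
    show "2 * pairs * c * congestion n d \<le> 32 * real d ^ 17 * real n ^ 6"
      using congestion_le[OF two_edges] by (simp only: pairs_def c_def mult.assoc)
    show "0 \<le> ?D" using dirichlet_form[of g] S0 pairs_pos by (simp add: S_def V_def)
  qed
  finally show ?thesis by (simp only: V_def)
qed simp

theorem theoremA1:
  fixes n d :: nat and \<epsilon> :: real
  assumes "0 < \<epsilon>" and "\<epsilon> < 1"
  shows "real (mixing_time (regular_bip n d) \<epsilon>)
    \<le> 32 * real d ^ 17 * real n ^ 6
       * (2 * real d * real n * ln (2 * real d * real n) + ln (1 / \<epsilon>))"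
proof (cases "2 \<le> d * n")
  case False
  have "0 \<le> 2 * real d * real n * ln (2 * real d * real n)"
  proof (cases "d * n = 0")
    case False
    then have "1 \<le> real (d * n)" by linarith
    then have "1 \<le> real d * real n" by (simp only: of_nat_mult)
    then show ?thesis by simp
  qed auto
  then show ?thesis using mixing_time_trivial[of d n \<epsilon>] False assms by simp
next
  case True
  interpret switch_chain n d using True by unfold_locales
  have dn: "1 \<le> d" "1 \<le> n" using True by (auto simp: Suc_le_eq intro: Nat.gr0I)
  have "1 \<le> real (d * n)" using True by linarith
  then have m: "1 \<le> real d * real n" by (simp only: of_nat_mult)
  have n_le: "real n \<le> 2 * real d * real n" using dn mult_mono[of 1 "2 * real d" "real n" "real n"] by simp
  have K0: "0 \<le> 2 * real d * real n * ln (2 * real d * real n)" using m by simp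
  have lnN: "ln (real (card \<Omega>)) / 2 \<le> 2 * real d * real n * ln (2 * real d * real n)"
  proof (cases "card \<Omega> = 0")
    case False
    then have "ln (real (card \<Omega>)) \<le> ln (real (n ^ (d * n)))"
      using card_regular_bip_le[of n d] dn by (subst ln_le_cancel_iff) (auto simp: Suc_le_eq)
    also have "\<dots> = real d * real n * ln (real n)" using dn by (simp add: ln_realpow)
    also have "\<dots> \<le> real d * real n * ln (2 * real d * real n)"
      using n_le dn m by (intro mult_left_mono) auto
    finally show ?thesis using K0 by linarith
  qed (use K0 in simp)
  \<comment> \<open>The rounding in \<open>mixing_time_le\<close> requires a constant of at least
    2.\<close>
  have "1 \<le> real d ^ 17" "1 \<le> real n ^ 6" using dn by (intro one_le_power; simp)+
  then have "1 * 1 \<le> real d ^ 17 * real n ^ 6" by (intro mult_mono) auto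
  then have "2 \<le> 32 * real d ^ 17 * real n ^ 6" unfolding mult.assoc by linarith
  then show ?thesis
    by (intro mixing_time_le finite_regular_bip switch_P_sym switch_P_psd switch_P_rows poincare assms lnN K0) auto
qed

end
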